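(* Let $n$ and $d$ be positive integers such that $n\ge 2d$. (i) If $n\equiv 0\pmod{40}$ and $d\equiv 4\pmod{40}$, then $\gamma^{ID}(C_n(1,d))=\frac{7n}{20}$. (ii) If $n\equiv 0\pmod{20}$ and $d\equiv 6\pmod{20}$, then $\gamma^{ID}(C_n(1,d))=\frac{7n}{20}$. (iii) If $n\equiv 0\pmod{20}$ and $d\equiv 5\pmod{20}$, then $\gamma^{LD}(C_n(1,d))=\frac{3n}{10}$.
   Context: All graphs are simple and undirected. For a graph $G=(V,E)$ and $u\in V$, $N[u]=\{u\}\cup\{v: uv\in E\}$. A code is a nonempty $C\subseteq V$, and $I(C;u)=N[u]\cap C$. $C$ is dominating if $I(C;u)\neq\emptyset$ for all $u$; identifying if dominating and $I(C;u)\neq I(C;v)$ for all distinct $u,v\in V$; locating-dominating if dominating and $I(C;u)\neq I(C;v)$ for all distinct $u,v\in V\setminus C$. $\gamma^{ID}(G)$ and $\gamma^{LD}(G)$ denote the minimum cardinality of an identifying, respectively locating-dominating, code in a finite graph $G$. For positive integers $n$ and $d_1,\dots,d_k\le n/2$, the circulant graph $C_n(d_1,\dots,d_k)$ has vertex set $\mathbb{Z}_n$, and the open neighbourhood of $u$ is $\{u\pm d_1,\dots,u\pm d_k\}$ modulo $n$. *)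

theory Defs
  imports Complex_Main "HOL-Number_Theory.Cong" "Graph_Theory.Pair_Digraph"
begin

text \<open>
  Simple undirected graphs are rendered as in the locales \<open>pair_bidirected_digraph\<close> and (finite
  case) \<open>pair_graph\<close>: the edge \<open>uv\<close> is the pair of opposite arcs \<open>(u, v)\<close> and \<open>(v, u)\<close>.
\<close>

definition closed_nbhd :: "'a pair_pre_digraph \<Rightarrow> 'a \<Rightarrow> 'a set" where
  "closed_nbhd G u = {u} \<union> {v. (u, v) \<in> parcs G}"

definition code :: "'a pair_pre_digraph \<Rightarrow> 'a set \<Rightarrow> bool" where
  "code G C \<longleftrightarrow> C \<noteq> {} \<and> C \<subseteq> pverts G"

definition I_set :: "'a pair_pre_digraph \<Rightarrow> 'a set \<Rightarrow> 'a \<Rightarrow> 'a set" where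
  "I_set G C u = closed_nbhd G u \<inter> C"

definition dominating_code :: "'a pair_pre_digraph \<Rightarrow> 'a set \<Rightarrow> bool" where
  "dominating_code G C \<longleftrightarrow> code G C \<and> (\<forall>u\<in>pverts G. I_set G C u \<noteq> {})"

definition identifying_code :: "'a pair_pre_digraph \<Rightarrow> 'a set \<Rightarrow> bool" where
  "identifying_code G C \<longleftrightarrow> dominating_code G C \<and>
     (\<forall>u\<in>pverts G. \<forall>v\<in>pverts G. u \<noteq> v \<longrightarrow> I_set G C u \<noteq> I_set G C v)"

definition locating_dominating_code :: "'a pair_pre_digraph \<Rightarrow> 'a set \<Rightarrow> bool" where
  "locating_dominating_code G C \<longleftrightarrow> dominating_code G C \<and>
     (\<forall>u\<in>pverts G - C. \<forall>v\<in>pverts G - C. u \<noteq> v \<longrightarrow> I_set G C u \<noteq> I_set G C v)"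

text \<open>
  A finite graph need not have an identifying code; then \<open>gamma_ID\<close> is the unspecified value
  \<open>Min {}\<close>.
\<close>

definition gamma_ID :: "'a pair_pre_digraph \<Rightarrow> nat" where
  "gamma_ID G = Min {card C | C. identifying_code G C}"

definition gamma_LD :: "'a pair_pre_digraph \<Rightarrow> nat" where
  "gamma_LD G = Min {card C | C. locating_dominating_code G C}"

text \<open>
  \<open>\<int>\<^sub>n\<close> is represented by the residues \<open>{0..<n}\<close>; the list \<open>ds\<close> holds the parameters
  \<open>d\<^sub>1, \<dots>, d\<^sub>k\<close>.
\<close>

definition circulant_graph :: "nat \<Rightarrow> nat list \<Rightarrow> int pair_pre_digraph" where
  "circulant_graph n ds =
     \<lparr> pverts = {0..<int n},
       parcs = {(u, v). u \<in> {0..<int n} \<and>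
         v \<in> (\<Union>d\<in>set ds. {(u + int d) mod int n, (u - int d) mod int n})} \<rparr>"

lemma circulant_pair_graph:
  assumes ds: "\<And>d. d \<in> set ds \<Longrightarrow> 0 < d \<and> 2 * d \<le> n" and n: "0 < n"
  shows "pair_graph (circulant_graph n ds)"
proof -
  let ?G = "circulant_graph n ds"
  have arc: "(u, v) \<in> parcs ?G \<longleftrightarrow> 0 \<le> u \<and> u < int n \<and>
      (\<exists>d\<in>set ds. v = (u + int d) mod int n \<or> v = (u - int d) mod int n)" for u v
    by (simp add: circulant_graph_def)
  have verts: "pverts ?G = {0..<int n}"
    by (simp add: circulant_graph_def)
  have range: "0 \<le> u \<and> u < int n \<and> 0 \<le> v \<and> v < int n" if "(u, v) \<in> parcs ?G" for u v
  proof -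
    from that obtain w where "v = w mod int n" and "0 \<le> u" "u < int n"
      unfolding arc by blast
    with n show ?thesis by simp
  qed
  have V: "parcs ?G \<subseteq> {0..<int n} \<times> {0..<int n}"
    using range by (simp add: subset_iff)
  have S: "(v, u) \<in> parcs ?G" if "(u, v) \<in> parcs ?G" for u v
  proof -
    from that obtain d where d: "d \<in> set ds" and u: "0 \<le> u" "u < int n"
      and v: "v = (u + int d) mod int n \<or> v = (u - int d) mod int n"
      unfolding arc by blast
    from v have "u = (v + int d) mod int n \<or> u = (v - int d) mod int n"
    proof
      assume "v = (u + int d) mod int n"
      with u have "u = (v - int d) mod int n"
        by (simp add: mod_diff_left_eq)
      then show ?thesis ..
    next
      assume "v = (u - int d) mod int n"
      with u have "u = (v + int d) mod int n"
        by (simp add: mod_add_left_eq)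
      then show ?thesis ..
    qed
    with d range[OF that] show ?thesis unfolding arc by blast
  qed
  have L: "u \<noteq> v" if "(u, v) \<in> parcs ?G" for u v
  proof
    assume "u = v"
    with that obtain d where d: "d \<in> set ds" and u: "0 \<le> u" "u < int n"
      and eq: "u = (u + int d) mod int n \<or> u = (u - int d) mod int n"
      unfolding arc by blast
    have "u mod int n = u" using u by simp
    with eq have "u mod int n = (u + int d) mod int n \<or> u mod int n = (u - int d) mod int n"
      by simp
    then have "int n dvd u - (u + int d) \<or> int n dvd u - (u - int d)"
      unfolding mod_eq_dvd_iff .
    then have "n dvd d" by simp
    moreover have "0 < d" "d < n" using ds[OF d] by linarith+
    ultimately show False using nat_dvd_not_less by blast
  qed
  show ?thesis
  proof
    show "finite (pverts ?G)" unfolding verts by simp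
    show "finite (parcs ?G)" using V by (rule finite_subset) simp
    show "symmetric (with_proj ?G)"
      unfolding symmetric_def with_proj_simps using S by (rule symI)
    fix e assume e: "e \<in> parcs ?G"
    obtain u v where uv: "e = (u, v)" by (cases e)
    show "fst e \<in> pverts ?G" "snd e \<in> pverts ?G"
      using range e unfolding uv verts by simp_all
    show "fst e \<noteq> snd e" using L e unfolding uv by simp
  qed
qed

end

theory Submission
  imports Defs
begin

text \<open>
  Reading a code of \<open>C\<^sub>n(1,d)\<close> along \<open>x + d y\<close> unrolls it to a periodic set of points of the
  square grid, in which closed neighbourhoods are crosses of five points. Let \<open>k v\<close> be the number of
  codewords in the cross of \<open>v\<close>.

  \<^bold>\<open>Identifying codes.\<close> Every codeword \<open>p\<close> is the only codeword in the cross of at most one vertex;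
  call \<open>p\<close> redundant if there is no such vertex. Double counting gives
  \<open>14 \<Sum> max 0 (k v - 2) + 14 #redundant = 84 |C| - 28 n\<close>, so \<open>|C| \<ge> 7 n / 20\<close> follows once every
  codeword can be given 4 units, where a vertex \<open>v\<close> with \<open>k v \<ge> 3\<close> (a father) owns \<open>14 (k v - 2)\<close>
    units
  and a redundant codeword owns 14. Fathers pay the codewords in their crosses. What remains are
  the orphans, the codewords with no father in the cross; an orphan is isolated, and the codewords
  nearest to it are the four at straight distance 2. Since each diagonal neighbour of an orphan
  must be dominated, there are fathers close to these four codewords, and they pay the orphan from
  what they have left. This suffices except for orphans whose surroundings look like a windmill;
  such an orphan gets one unit from another orphan, which has a surplus.

  \<^bold>\<open>Locating-dominating codes.\<close> The share \<open>\<Sum> 1 / k v\<close> over the cross of a codeword sums to \<open>n\<close>. It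
  exceeds \<open>10 / 3\<close> only for isolated codewords of share \<open>7 / 2\<close>, and these can pass \<open>1 / 6\<close> on to a
  codeword at straight distance 2 which has a neighbour in the code.

  \<^bold>\<open>Upper bounds\<close> come from unions of residue classes modulo 20 or 40.
\<close>

section \<open>Grid patterns and their symmetries\<close>

definition shift :: "int \<Rightarrow> int \<Rightarrow> (int \<Rightarrow> int \<Rightarrow> bool) \<Rightarrow> int \<Rightarrow> int \<Rightarrow> bool" where
  "shift a b c = (\<lambda>x y. c (a + x) (b + y))"

definition rot :: "(int \<Rightarrow> int \<Rightarrow> bool) \<Rightarrow> int \<Rightarrow> int \<Rightarrow> bool" where
  "rot c = (\<lambda>x y. c (- y) x)"

definition flip :: "(int \<Rightarrow> int \<Rightarrow> bool) \<Rightarrow> int \<Rightarrow> int \<Rightarrow> bool" where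
  "flip c = (\<lambda>x y. c x (- y))"

lemma shift_apply [simp]: "shift a b c x y = c (a + x) (b + y)"
  by (simp add: shift_def)

lemma rot_apply [simp]: "rot c x y = c (- y) x"
  by (simp add: rot_def)

lemma flip_apply [simp]: "flip c x y = c x (- y)"
  by (simp add: flip_def)

lemma shift_shift [simp]: "shift a b (shift a' b' c) = shift (a' + a) (b' + b) c"
  by (simp add: shift_def add.assoc)

lemma shift_0 [simp]: "shift 0 0 c = c"
  by (simp add: shift_def)

lemma shift_rot [simp]: "shift a b (rot c) = rot (shift (- b) a c)"
  by (simp add: shift_def rot_def minus_diff_commute)

lemma shift_flip [simp]: "shift a b (flip c) = flip (shift a (- b) c)"
  by (simp add: shift_def flip_def minus_diff_commute)

lemma rot_rot_rot_rot [simp]: "rot (rot (rot (rot c))) = c"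
  by (simp add: rot_def)

lemma flip_flip [simp]: "flip (flip c) = c"
  by (simp add: flip_def)

lemma flip_rot: "flip (rot c) = rot (rot (rot (flip c)))"
  by (simp add: flip_def rot_def)

text \<open>
  Only vertices at distance at most 2 need to be separated explicitly: the pairs are the vertex
  \<open>(x, y)\<close> and its translates by \<open>(1,0)\<close>, \<open>(0,1)\<close>, \<open>(2,0)\<close>, \<open>(0,2)\<close>, \<open>(1,1)\<close>, \<open>(1,-1)\<close>, and each
  disjunction runs over the symmetric difference of the two crosses.
\<close>

definition ident :: "(int \<Rightarrow> int \<Rightarrow> bool) \<Rightarrow> bool" where
  "ident c \<longleftrightarrow> (\<forall>x y.
     (c x y \<or> c (x + 1) y \<or> c (x - 1) y \<or> c x (y + 1) \<or> c x (y - 1)) \<and>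
     (c (x - 1) y \<or> c x (y + 1) \<or> c x (y - 1) \<or> c (x + 2) y \<or> c (x + 1) (y + 1) \<or> c (x + 1) (y - 1))
       \<and>
     (c x (y - 1) \<or> c (x + 1) y \<or> c (x - 1) y \<or> c x (y + 2) \<or> c (x + 1) (y + 1) \<or> c (x - 1) (y + 1))
       \<and>
     (c x y \<or> c (x - 1) y \<or> c x (y + 1) \<or> c x (y - 1) \<or>
      c (x + 2) y \<or> c (x + 3) y \<or> c (x + 2) (y + 1) \<or> c (x + 2) (y - 1)) \<and>
     (c x y \<or> c x (y - 1) \<or> c (x + 1) y \<or> c (x - 1) y \<or>
      c x (y + 2) \<or> c x (y + 3) \<or> c (x + 1) (y + 2) \<or> c (x - 1) (y + 2)) \<and>
     (c x y \<or> c (x - 1) y \<or> c x (y - 1) \<or> c (x + 1) (y + 1) \<or> c (x + 2) (y + 1) \<or> c (x + 1) (y + 2))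
       \<and>
     (c x y \<or> c (x - 1) y \<or> c x (y + 1) \<or> c (x + 1) (y - 1) \<or> c (x + 2) (y - 1) \<or> c (x + 1)
       (y - 2)))"

lemma
  assumes "ident c"
  shows dom: "c x y \<or> c (x + 1) y \<or> c (x - 1) y \<or> c x (y + 1) \<or> c x (y - 1)"
    and s10: "c (x - 1) y \<or> c x (y + 1) \<or> c x (y - 1) \<or> c (x + 2) y \<or> c (x + 1) (y + 1) \<or> c (x + 1)
      (y - 1)"
    and s01: "c x (y - 1) \<or> c (x + 1) y \<or> c (x - 1) y \<or> c x (y + 2) \<or> c (x + 1) (y + 1) \<or> c (x - 1)
      (y + 1)"
    and s20: "c x y \<or> c (x - 1) y \<or> c x (y + 1) \<or> c x (y - 1) \<or>
      c (x + 2) y \<or> c (x + 3) y \<or> c (x + 2) (y + 1) \<or> c (x + 2) (y - 1)"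
    and s02: "c x y \<or> c x (y - 1) \<or> c (x + 1) y \<or> c (x - 1) y \<or>
      c x (y + 2) \<or> c x (y + 3) \<or> c (x + 1) (y + 2) \<or> c (x - 1) (y + 2)"
    and s11: "c x y \<or> c (x - 1) y \<or> c x (y - 1) \<or> c (x + 1) (y + 1) \<or> c (x + 2) (y + 1) \<or> c (x + 1)
      (y + 2)"
    and s1m: "c x y \<or> c (x - 1) y \<or> c x (y + 1) \<or> c (x + 1) (y - 1) \<or> c (x + 2) (y - 1) \<or> c (x + 1)
      (y - 2)"
  using assms unfolding ident_def by blast+

lemma ident_shift [simp]: "ident c \<Longrightarrow> ident (shift a b c)"
  unfolding ident_def shift_apply add.assoc[symmetric] add_diff_eq by blast

lemma ident_rot [simp]:
  assumes "ident c"
  shows "ident (rot c)"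
  unfolding ident_def rot_apply
proof (intro allI conjI, goal_cases)
  case (1 x y)
  then show ?case
    using dom[OF assms, of "- y" x] by (auto simp: algebra_simps minus_diff_commute)
next
  case (2 x y)
  then show ?case
    using s01[OF assms, of "- y" x] by (auto simp: algebra_simps minus_diff_commute)
next
  case (3 x y)
  then show ?case
    using s10[OF assms, of "- y - 1" x] by (auto simp: algebra_simps minus_diff_commute)
next
  case (4 x y)
  then show ?case
    using s02[OF assms, of "- y" x] by (auto simp: algebra_simps minus_diff_commute)
next
  case (5 x y)
  then show ?case
    using s20[OF assms, of "- y - 2" x] by (auto simp: algebra_simps minus_diff_commute)
next
  case (6 x y)
  then show ?case
    using s1m[OF assms, of "- y - 1" "x + 1"] by (auto simp: algebra_simps minus_diff_commute)
next
  case (7 x y)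
  then show ?case
    using s11[OF assms, of "- y" x] by (auto simp: algebra_simps minus_diff_commute)
qed

lemma ident_flip [simp]:
  assumes "ident c"
  shows "ident (flip c)"
  unfolding ident_def flip_apply
proof (intro allI conjI, goal_cases)
  case (1 x y)
  then show ?case
    using dom[OF assms, of x "- y"] by (auto simp: algebra_simps minus_diff_commute)
next
  case (2 x y)
  then show ?case
    using s10[OF assms, of x "- y"] by (auto simp: algebra_simps minus_diff_commute)
next
  case (3 x y)
  then show ?case
    using s01[OF assms, of x "- y - 1"] by (auto simp: algebra_simps minus_diff_commute)
next
  case (4 x y)
  then show ?case
    using s20[OF assms, of x "- y"] by (auto simp: algebra_simps minus_diff_commute)
next
  case (5 x y)
  then show ?case
    using s02[OF assms, of x "- y - 2"] by (auto simp: algebra_simps minus_diff_commute)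
next
  case (6 x y)
  then show ?case
    using s1m[OF assms, of x "- y"] by (auto simp: algebra_simps minus_diff_commute)
next
  case (7 x y)
  then show ?case
    using s11[OF assms, of x "- y"] by (auto simp: algebra_simps minus_diff_commute)
qed

section \<open>Weights, fathers, orphans and the payments between them\<close>

text \<open>
  All predicates below speak about the origin of the pattern; other places and orientations are
  reached by \<open>shift\<close>, \<open>rot\<close> and \<open>flip\<close>.
\<close>

definition weight :: "(int \<Rightarrow> int \<Rightarrow> bool) \<Rightarrow> nat" where
  "weight c = of_bool (c 0 0) + of_bool (c 1 0) + of_bool (c (- 1) 0) +
     of_bool (c 0 1) + of_bool (c 0 (- 1))"

definition father :: "(int \<Rightarrow> int \<Rightarrow> bool) \<Rightarrow> bool" where
  "father c \<longleftrightarrow> 3 \<le> weight c"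

definition redundant :: "(int \<Rightarrow> int \<Rightarrow> bool) \<Rightarrow> bool" where
  "redundant c \<longleftrightarrow> c 0 0 \<and> weight c \<noteq> 1 \<and> weight (shift 1 0 c) \<noteq> 1 \<and> weight (shift (- 1) 0 c) \<noteq> 1 \<and>
     weight (shift 0 1 c) \<noteq> 1 \<and> weight (shift 0 (- 1) c) \<noteq> 1"

text \<open>Under \<open>ident\<close> these are exactly the codewords without a father in the
  cross, see \<open>orphan_or_father\<close>. The explicit pattern is what propositional reasoning
  works with.\<close>

definition orphan :: "(int \<Rightarrow> int \<Rightarrow> bool) \<Rightarrow> bool" where
  "orphan c \<longleftrightarrow> c 0 0 \<and> c 2 0 \<and> c (- 2) 0 \<and> c 0 2 \<and> c 0 (- 2) \<and>
     \<not> c 1 0 \<and> \<not> c (- 1) 0 \<and> \<not> c 0 1 \<and> \<not> c 0 (- 1) \<and>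
     \<not> c 1 1 \<and> \<not> c 1 (- 1) \<and> \<not> c (- 1) 1 \<and> \<not> c (- 1) (- 1)"

text \<open>
  After paying the codewords in its cross, a code father that is \<open>single\<close> keeps exactly 2 units and
  one that is \<open>rich\<close> keeps at least 6.
\<close>

definition single :: "(int \<Rightarrow> int \<Rightarrow> bool) \<Rightarrow> bool" where
  "single c \<longleftrightarrow> c 0 0 \<and> weight c = 3 \<and> \<not> redundant c \<and>
     \<not> father (shift 1 0 c) \<and> \<not> father (shift (- 1) 0 c) \<and>
     \<not> father (shift 0 1 c) \<and> \<not> father (shift 0 (- 1) c) \<and>
     (c 1 0 \<longrightarrow> \<not> redundant (shift 1 0 c) \<and> \<not> father (shift 2 0 c) \<and>
        \<not> father (shift 1 1 c) \<and> \<not> father (shift 1 (- 1) c)) \<and>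
     (c (- 1) 0 \<longrightarrow> \<not> redundant (shift (- 1) 0 c) \<and> \<not> father (shift (- 2) 0 c) \<and>
        \<not> father (shift (- 1) 1 c) \<and> \<not> father (shift (- 1) (- 1) c)) \<and>
     (c 0 1 \<longrightarrow> \<not> redundant (shift 0 1 c) \<and> \<not> father (shift 0 2 c) \<and>
        \<not> father (shift 1 1 c) \<and> \<not> father (shift (- 1) 1 c)) \<and>
     (c 0 (- 1) \<longrightarrow> \<not> redundant (shift 0 (- 1) c) \<and> \<not> father (shift 0 (- 2) c) \<and>
        \<not> father (shift 1 (- 1) c) \<and> \<not> father (shift (- 1) (- 1) c))"

definition rich :: "(int \<Rightarrow> int \<Rightarrow> bool) \<Rightarrow> bool" where
  "rich c \<longleftrightarrow> c 0 0 \<and> father c \<and> \<not> single c"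

text \<open>Offsets at which an orphan has a claim on the father at the origin: straight distance 2
  and knight's moves. \<open>load16\<close> adds straight distance 3, where only rich fathers
  pay.\<close>

definition load12 :: "(int \<Rightarrow> int \<Rightarrow> bool) \<Rightarrow> nat" where
  "load12 c = of_bool (orphan (shift 2 0 c)) + of_bool (orphan (shift (- 2) 0 c)) +
     of_bool (orphan (shift 0 2 c)) + of_bool (orphan (shift 0 (- 2) c)) +
     of_bool (orphan (shift 2 1 c)) + of_bool (orphan (shift 2 (- 1) c)) +
     of_bool (orphan (shift (- 2) 1 c)) + of_bool (orphan (shift (- 2) (- 1) c)) +
     of_bool (orphan (shift 1 2 c)) + of_bool (orphan (shift (- 1) 2 c)) +
     of_bool (orphan (shift 1 (- 2) c)) + of_bool (orphan (shift (- 1) (- 2) c))"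

definition load16 :: "(int \<Rightarrow> int \<Rightarrow> bool) \<Rightarrow> nat" where
  "load16 c = load12 c + of_bool (orphan (shift 3 0 c)) + of_bool (orphan (shift (- 3) 0 c)) +
     of_bool (orphan (shift 0 3 c)) + of_bool (orphan (shift 0 (- 3) c))"

text \<open>
  A single father in the middle of a line of three codewords gives all it has to the orphan facing
  the middle, if there is one (the \<open>centre\<close> orphan, see also \<open>side_share\<close>).
\<close>

definition has_centre :: "(int \<Rightarrow> int \<Rightarrow> bool) \<Rightarrow> bool" where
  "has_centre c \<longleftrightarrow> c 1 0 \<and> c (- 1) 0 \<and> (orphan (shift 0 2 c) \<or> orphan (shift 0 (- 2) c)) \<or>
     c 0 1 \<and> c 0 (- 1) \<and> (orphan (shift 2 0 c) \<or> orphan (shift (- 2) 0 c))"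

text \<open>The amount for each orphan with a claim. A rich father can spend 6 on at most three
  orphans, so 3 each for two or 2 each for three. A single father has 2 for at most two orphans,
  unless all of it goes to a centre orphan.\<close>

definition share :: "(int \<Rightarrow> int \<Rightarrow> bool) \<Rightarrow> nat" where
  "share c = (if rich c then if load16 c \<le> 2 then 3 else 2
     else if single c \<and> \<not> has_centre c then if load12 c \<le> 1 then 2 else 1 else 0)"

definition side_share :: "(int \<Rightarrow> int \<Rightarrow> bool) \<Rightarrow> nat" where
  "side_share c = (if single c \<and> c 0 1 \<and> c 0 (- 1) then 2 else share c)"

text \<open>Income of the orphan at the origin from its right side; the other three sides are
  reached by \<open>rot\<close>.\<close>

definition sval :: "(int \<Rightarrow> int \<Rightarrow> bool) \<Rightarrow> nat" where
  "sval c = side_share (shift 2 0 c) + share (shift 2 1 c) + share (shift 2 (- 1) c) +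
     of_bool (rich (shift 3 0 c)) * share (shift 3 0 c)"

definition recv :: "(int \<Rightarrow> int \<Rightarrow> bool) \<Rightarrow> nat" where
  "recv c = sval c + sval (rot c) + sval (rot (rot c)) + sval (rot (rot (rot c)))"

text \<open>
  The side of the orphan at the origin is of no use to it: the father there pays the centre orphan
  on the other side of the line.
\<close>

definition Yoff :: "(int \<Rightarrow> int \<Rightarrow> bool) \<Rightarrow> bool" where
  "Yoff c \<longleftrightarrow> c 2 0 \<and> c 2 2 \<and> single (shift 2 1 c) \<and> orphan (shift 4 1 c)"

text \<open>
  Of a windmill, the sides with positive \<open>sval\<close> do not suffice only if two consecutive sides are
  of the kind \<open>Yoff\<close>. The donor is the centre orphan at \<open>(4,1)\<close>.
\<close>

definition gift :: "(int \<Rightarrow> int \<Rightarrow> bool) \<Rightarrow> bool" where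
  "gift c \<longleftrightarrow> orphan c \<and> Yoff c \<and> Yoff (rot (rot (rot c))) \<and> c (- 1) 2"

definition gifts_in :: "(int \<Rightarrow> int \<Rightarrow> bool) \<Rightarrow> nat" where
  "gifts_in c = of_bool (gift c) + of_bool (gift (rot c)) + of_bool (gift (rot (rot c))) +
     of_bool (gift (rot (rot (rot c)))) + of_bool (gift (flip c)) + of_bool (gift (rot (flip c))) +
     of_bool (gift (rot (rot (flip c)))) + of_bool (gift (rot (rot (rot (flip c)))))"

text \<open>The same gift seen from the donor at the origin: the receiver lies at (-4, -1).\<close>

definition gift_out :: "(int \<Rightarrow> int \<Rightarrow> bool) \<Rightarrow> bool" where
  "gift_out c \<longleftrightarrow> gift (shift (- 4) (- 1) c)"

definition gifts_out :: "(int \<Rightarrow> int \<Rightarrow> bool) \<Rightarrow> nat" where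
  "gifts_out c = of_bool (gift_out c) + of_bool (gift_out (rot c)) + of_bool
    (gift_out (rot (rot c))) +
     of_bool (gift_out (rot (rot (rot c)))) + of_bool (gift_out (flip c)) + of_bool
       (gift_out (rot (flip c))) +
     of_bool (gift_out (rot (rot (flip c)))) + of_bool (gift_out (rot (rot (rot (flip c)))))"

section \<open>Invariance under rotation and reflection\<close>

lemma weight_rot [simp]: "weight (rot c) = weight c"
  by (simp add: weight_def)

lemma weight_flip [simp]: "weight (flip c) = weight c"
  by (simp add: weight_def)

lemma father_rot [simp]: "father (rot c) = father c"
  by (simp add: father_def)

lemma father_flip [simp]: "father (flip c) = father c"
  by (simp add: father_def)

lemma redundant_rot [simp]: "redundant (rot c) = redundant c"
  by (simp add: redundant_def conj_ac disj_ac)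

lemma redundant_flip [simp]: "redundant (flip c) = redundant c"
  by (simp add: redundant_def conj_ac disj_ac)

lemma orphan_rot [simp]: "orphan (rot c) = orphan c"
  by (simp add: orphan_def conj_ac disj_ac)

lemma orphan_flip [simp]: "orphan (flip c) = orphan c"
  by (simp add: orphan_def conj_ac disj_ac)

lemma single_rot [simp]: "single (rot c) = single c"
  by (simp add: single_def conj_ac disj_ac)

lemma single_flip [simp]: "single (flip c) = single c"
  by (simp add: single_def conj_ac disj_ac)

lemma rich_rot [simp]: "rich (rot c) = rich c"
  by (simp add: rich_def)

lemma rich_flip [simp]: "rich (flip c) = rich c"
  by (simp add: rich_def)

lemma load12_rot [simp]: "load12 (rot c) = load12 c"
  by (simp add: load12_def)

lemma load12_flip [simp]: "load12 (flip c) = load12 c"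
  by (simp add: load12_def)

lemma load16_rot [simp]: "load16 (rot c) = load16 c"
  by (simp add: load16_def)

lemma load16_flip [simp]: "load16 (flip c) = load16 c"
  by (simp add: load16_def)

lemma has_centre_rot [simp]: "has_centre (rot c) = has_centre c"
  by (simp add: has_centre_def conj_ac disj_ac)

lemma has_centre_flip [simp]: "has_centre (flip c) = has_centre c"
  by (simp add: has_centre_def conj_ac disj_ac)

lemma share_rot [simp]: "share (rot c) = share c"
  by (simp add: share_def)

lemma share_flip [simp]: "share (flip c) = share c"
  by (simp add: share_def)

lemma side_share_flip [simp]: "side_share (flip c) = side_share c"
  by (simp add: side_share_def conj_ac disj_ac)

lemma sval_flip [simp]: "sval (flip c) = sval c"
  by (simp add: sval_def)

lemma recv_rot [simp]: "recv (rot c) = recv c"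
  by (simp add: recv_def)

lemma recv_flip [simp]: "recv (flip c) = recv c"
proof -
  have e: "rot (flip c) = flip (rot (rot (rot c)))" "rot (flip (rot c)) = flip c"
    "rot (flip (rot (rot c))) = flip (rot c)" "rot (flip (rot (rot (rot c)))) = flip (rot (rot c))"
    by (simp_all add: flip_def rot_def)
  show ?thesis
    by (simp add: recv_def e)
qed

lemma gifts_in_rot [simp]: "gifts_in (rot c) = gifts_in c"
  by (simp add: gifts_in_def flip_rot)

lemma gifts_in_flip [simp]: "gifts_in (flip c) = gifts_in c"
  by (simp add: gifts_in_def)

lemma gifts_out_rot [simp]: "gifts_out (rot c) = gifts_out c"
  by (simp add: gifts_out_def flip_rot)

lemma gifts_out_flip [simp]: "gifts_out (flip c) = gifts_out c"
  by (simp add: gifts_out_def)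

section \<open>Clause forms of the counting predicates\<close>

text \<open>At least three of five hold iff every three of them include one that holds; dually, at
  most two hold iff every three include one that fails. In this form \<open>sat\<close> can use the
  predicates.\<close>

lemma father_cnf:
  "father c \<longleftrightarrow>
    (c 0 0 \<or> c 1 0 \<or> c (- 1) 0) \<and> (c 0 0 \<or> c 1 0 \<or> c 0 1) \<and> (c 0 0 \<or> c 1 0 \<or> c 0 (- 1)) \<and>
    (c 0 0 \<or> c (- 1) 0 \<or> c 0 1) \<and> (c 0 0 \<or> c (- 1) 0 \<or> c 0 (- 1)) \<and> (c 0 0 \<or> c 0 1 \<or> c 0 (- 1)) \<and>
    (c 1 0 \<or> c (- 1) 0 \<or> c 0 1) \<and> (c 1 0 \<or> c (- 1) 0 \<or> c 0 (- 1)) \<and> (c 1 0 \<or> c 0 1 \<or> c 0 (- 1)) \<and>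
    (c (- 1) 0 \<or> c 0 1 \<or> c 0 (- 1))"
  unfolding father_def weight_def
  by (cases "c 0 0"; cases "c 1 0"; cases "c (- 1) 0"; cases "c 0 1"; cases "c 0 (- 1)"; simp)

lemma not_father_cnf:
  "\<not> father c \<longleftrightarrow>
    (\<not> c 0 0 \<or> \<not> c 1 0 \<or> \<not> c (- 1) 0) \<and> (\<not> c 0 0 \<or> \<not> c 1 0 \<or> \<not> c 0 1) \<and>
    (\<not> c 0 0 \<or> \<not> c 1 0 \<or> \<not> c 0 (- 1)) \<and> (\<not> c 0 0 \<or> \<not> c (- 1) 0 \<or> \<not> c 0 1) \<and>
    (\<not> c 0 0 \<or> \<not> c (- 1) 0 \<or> \<not> c 0 (- 1)) \<and> (\<not> c 0 0 \<or> \<not> c 0 1 \<or> \<not> c 0 (- 1)) \<and>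
    (\<not> c 1 0 \<or> \<not> c (- 1) 0 \<or> \<not> c 0 1) \<and> (\<not> c 1 0 \<or> \<not> c (- 1) 0 \<or> \<not> c 0 (- 1)) \<and>
    (\<not> c 1 0 \<or> \<not> c 0 1 \<or> \<not> c 0 (- 1)) \<and> (\<not> c (- 1) 0 \<or> \<not> c 0 1 \<or> \<not> c 0 (- 1))"
  unfolding father_def weight_def
  by (cases "c 0 0"; cases "c 1 0"; cases "c (- 1) 0"; cases "c 0 1"; cases "c 0 (- 1)"; simp)

lemma redundant_cnf:
  "redundant c \<longleftrightarrow> c 0 0 \<and> (c 1 0 \<or> c (- 1) 0 \<or> c 0 1 \<or> c 0 (- 1)) \<and>
    (c 1 0 \<or> c 2 0 \<or> c 1 1 \<or> c 1 (- 1)) \<and> (c (- 1) 0 \<or> c (- 2) 0 \<or> c (- 1) 1 \<or> c (- 1) (- 1)) \<and>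
    (c 0 1 \<or> c 0 2 \<or> c 1 1 \<or> c (- 1) 1) \<and> (c 0 (- 1) \<or> c 0 (- 2) \<or> c 1 (- 1) \<or> c (- 1) (- 1))"
  unfolding redundant_def weight_def by (auto simp: of_bool_def)

lemma weight3:
  "c 0 0 \<Longrightarrow> weight c = 3 \<longleftrightarrow>
     c 1 0 \<and> c (- 1) 0 \<and> \<not> c 0 1 \<and> \<not> c 0 (- 1) \<or> \<not> c 1 0 \<and> \<not> c (- 1) 0 \<and> c 0 1 \<and> c 0 (- 1) \<or>
     c 1 0 \<and> \<not> c (- 1) 0 \<and> c 0 1 \<and> \<not> c 0 (- 1) \<or> c 1 0 \<and> \<not> c (- 1) 0 \<and> \<not> c 0 1 \<and> c 0 (- 1) \<or>
     \<not> c 1 0 \<and> c (- 1) 0 \<and> c 0 1 \<and> \<not> c 0 (- 1) \<or> \<not> c 1 0 \<and> c (- 1) 0 \<and> \<not> c 0 1 \<and> c 0 (- 1)"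
  unfolding weight_def
  by (cases "c 1 0"; cases "c (- 1) 0"; cases "c 0 1"; cases "c 0 (- 1)"; simp)

section \<open>Orphans and single fathers\<close>

lemma orphan_shift:
  "orphan (shift a b c) \<longleftrightarrow> c a b \<and> c (a + 2) b \<and> c (a - 2) b \<and> c a (b + 2) \<and> c a (b - 2) \<and>
     \<not> c (a + 1) b \<and> \<not> c (a - 1) b \<and> \<not> c a (b + 1) \<and> \<not> c a (b - 1) \<and>
     \<not> c (a + 1) (b + 1) \<and> \<not> c (a + 1) (b - 1) \<and> \<not> c (a - 1) (b + 1) \<and> \<not> c (a - 1) (b - 1)"
  by (simp add: orphan_def)

text \<open>An adjacent or diagonal codeword would give two vertices that both see it and the
  origin; separating them puts a third codeword into one of their crosses, which makes a father.
  With the 3 by 3 block empty around the origin, its neighbours differ from the origin only by the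
  codewords at straight distance 2.\<close>

lemma orphan_or_father:
  assumes "ident c" "c 0 0" "\<not> father c" "\<not> father (shift 1 0 c)" "\<not> father (shift (- 1) 0 c)"
    "\<not> father (shift 0 1 c)" "\<not> father (shift 0 (- 1) c)"
  shows "orphan c"
  unfolding orphan_def
  using assms[unfolded not_father_cnf, simplified]
   s10[OF assms(1), of "-1" 0, simplified] s11[OF assms(1), of "-1" 0, simplified]
     s1m[OF assms(1), of "-1" 0, simplified]
   s01[OF assms(1), of 0 "-1", simplified] s11[OF assms(1), of 0 "-1", simplified]
     s10[OF assms(1), of 0 0, simplified]
   s01[OF assms(1), of 0 0, simplified] s1m[OF assms(1), of 0 1, simplified]
  by sat

text \<open>Each end of the line already has two codewords in its cross, so a further one would make
  it a second father. The disjunctions say that no other neighbour of an end is a father and that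
  none of the three codewords is redundant.\<close>

lemma single_line:
  assumes "single c" "c 1 0" "c (- 1) 0"
  shows "c 0 0 \<and> c 1 0 \<and> c (- 1) 0 \<and> \<not> c 0 1 \<and> \<not> c 0 (- 1) \<and> \<not> c 2 0 \<and> \<not> c (- 2) 0 \<and>
    \<not> c 1 1 \<and> \<not> c 1 (- 1) \<and> \<not> c (- 1) 1 \<and> \<not> c (- 1) (- 1) \<and> (\<not> c 0 2 \<or> \<not> c 0 (- 2)) \<and>
    (\<not> c 2 1 \<or> \<not> c 1 2) \<and> (\<not> c 2 (- 1) \<or> \<not> c 1 (- 2)) \<and>
    (\<not> c (- 2) 1 \<or> \<not> c (- 1) 2) \<and> (\<not> c (- 2) (- 1) \<or> \<not> c (- 1) (- 2)) \<and>
    (\<not> c 3 0 \<or> \<not> c 2 1) \<and> (\<not> c 3 0 \<or> \<not> c 2 (- 1)) \<and> (\<not> c 2 1 \<or> \<not> c 2 (- 1)) \<and>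
    (\<not> c (- 3) 0 \<or> \<not> c (- 2) 1) \<and> (\<not> c (- 3) 0 \<or> \<not> c (- 2) (- 1)) \<and>
      (\<not> c (- 2) 1 \<or> \<not> c (- 2) (- 1)) \<and>
    (\<not> c 2 1 \<and> \<not> c 1 2 \<or> \<not> c 2 (- 1) \<and> \<not> c 1 (- 2) \<or> \<not> c 3 0 \<and> \<not> c 2 1 \<and> \<not> c 2 (- 1)) \<and>
    (\<not> c (- 2) 1 \<and> \<not> c (- 1) 2 \<or> \<not> c (- 2) (- 1) \<and> \<not> c (- 1) (- 2) \<or>
      \<not> c (- 3) 0 \<and> \<not> c (- 2) 1 \<and> \<not> c (- 2) (- 1))"
proof -
  have "c 0 0" "weight c = 3"
    using assms by (simp_all add: single_def)
  with assms show ?thesis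
    by (simp add: weight3) (simp add: single_def not_father_cnf redundant_cnf, sat)
qed

text \<open>A codeword at (-1, -1) lies in the crosses of both neighbours of the origin that could
  be private to it and would make the origin redundant; (2, -1) and (-1, 2) do the same to (1, 0)
  and (0, 1).\<close>

lemma single_corner:
  assumes "single c" "c 1 0" "c 0 1"
  shows "c 0 0 \<and> c 1 0 \<and> c 0 1 \<and> \<not> c (- 1) 0 \<and> \<not> c 0 (- 1) \<and> \<not> c 2 0 \<and> \<not> c 1 (- 1) \<and> \<not> c 1 1 \<and>
    \<not> c 0 2 \<and> \<not> c (- 1) 1 \<and> \<not> c 2 1 \<and> \<not> c 1 2 \<and>
    \<not> c (- 1) (- 1) \<and> \<not> c 2 (- 1) \<and> \<not> c (- 1) 2 \<and>
    (\<not> c (- 2) 0 \<or> \<not> c 0 (- 2)) \<and> (\<not> c 1 (- 2) \<or> \<not> c 3 0) \<and> (\<not> c (- 2) 1 \<or> \<not> c 0 3)"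
proof -
  have "c 0 0" "weight c = 3"
    using assms by (simp_all add: single_def)
  with assms show ?thesis
    by (simp add: weight3) (simp add: single_def not_father_cnf redundant_cnf, sat)
qed

lemma single_cases:
  assumes "single c"
  shows "c 1 0 \<and> c (- 1) 0 \<or> c 0 1 \<and> c 0 (- 1) \<or> c 1 0 \<and> c 0 1 \<or> c 1 0 \<and> c 0 (- 1) \<or>
     c (- 1) 0 \<and> c 0 1 \<or> c (- 1) 0 \<and> c 0 (- 1)"
proof -
  have "c 0 0" "weight c = 3"
    using assms by (simp_all add: single_def)
  then show ?thesis
    by (auto simp add: weight3)
qed

text \<open>Both orphans clear their surroundings, so (2, -1) and (3, 0) can be separated only by
  (2, -2), and (2, 3) and (3, 2) only by (2, 4) or (1, 3). A codeword at (3, -1) or (3, 3) would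
  then make (2, -1) or (2, 3) a father next to an end of the line, against singleness.\<close>

lemma Yoff_std:
  assumes "ident c" "orphan c" "Yoff c"
  shows "c 2 (- 2) \<and> \<not> c 3 (- 1) \<and> \<not> c 3 3 \<and> (c 2 4 \<or> c 1 3)"
  using assms(2)[unfolded orphan_def] assms(3)[unfolded Yoff_def] orphan_shift[of 4 1 c, simplified]
    single_line[of "rot (shift 2 1 c)", simplified] s11[OF assms(1), of 2 "-1", simplified]
   s1m[OF assms(1), of 2 3, simplified]
  by sat

section \<open>What a father pays to orphans\<close>

text \<open>\<open>z\<close> lists the offsets at which the pattern of an orphan contradicts that of
  the father. \<open>k\<close> lists sets of the other offsets that are incompatible: the patterns
  clash, or a vertex stays undominated, or two vertices next to the father see the same single
  codeword. The other shapes are treated alike.\<close>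

lemma load16_line:
  assumes id: "ident c" and h: "c 0 0" "c 1 0" "c (- 1) 0" "\<not> c 0 1" "\<not> c 0 (- 1)"
  shows "load16 c \<le> 3"
proof -
  have z: "\<not> orphan (shift 2 0 c)" "\<not> orphan (shift (- 2) 0 c)" "\<not> orphan (shift 2 1 c)"
    "\<not> orphan (shift 2 (- 1) c)" "\<not> orphan (shift (- 2) 1 c)"
    "\<not> orphan (shift (- 2) (- 1) c)" "\<not> orphan (shift 0 3 c)"
    "\<not> orphan (shift 0 (- 3) c)"
    using h orphan_shift[of 2 0 c, simplified] orphan_shift[of "- 2" 0 c, simplified]
      orphan_shift[of 2 1 c, simplified] orphan_shift[of 2 "- 1" c, simplified]
      orphan_shift[of "- 2" 1 c, simplified] orphan_shift[of "- 2" "- 1" c, simplified]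
      orphan_shift[of 0 3 c, simplified] orphan_shift[of 0 "- 3" c, simplified]
    by sat+
  have k: "\<not> (orphan (shift 0 2 c) \<and> orphan (shift 1 2 c))"
    "\<not> (orphan (shift 0 2 c) \<and> orphan (shift (- 1) 2 c))"
    "\<not> (orphan (shift 0 (- 2) c) \<and> orphan (shift 1 (- 2) c))"
    "\<not> (orphan (shift 0 (- 2) c) \<and> orphan (shift (- 1) (- 2) c))"
    "\<not> (orphan (shift 1 2 c) \<and> orphan (shift 3 0 c))"
    "\<not> (orphan (shift (- 1) 2 c) \<and> orphan (shift (- 3) 0 c))"
    "\<not> (orphan (shift 1 (- 2) c) \<and> orphan (shift 3 0 c))"
    "\<not> (orphan (shift (- 1) (- 2) c) \<and> orphan (shift (- 3) 0 c))"
    "\<not> (orphan (shift 0 2 c) \<and> orphan (shift 0 (- 2) c) \<and> orphan (shift 3 0 c))"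
    "\<not> (orphan (shift 1 2 c) \<and> orphan (shift (- 1) 2 c) \<and> orphan (shift 1 (- 2) c) \<and> orphan
      (shift (- 1) (- 2) c))"
    using h orphan_shift[of 0 2 c, simplified] orphan_shift[of 1 2 c, simplified]
      orphan_shift[of "- 1" 2 c, simplified] orphan_shift[of 0 "- 2" c, simplified]
      orphan_shift[of 1 "- 2" c, simplified] orphan_shift[of "- 1" "- 2" c, simplified]
      orphan_shift[of 3 0 c, simplified] dom[OF id, of 2 1, simplified]
        orphan_shift[of "- 3" 0 c, simplified]
      dom[OF id, of "- 2" 1, simplified] dom[OF id, of 2 "- 1", simplified]
      dom[OF id, of "- 2" "- 1", simplified] s02[OF id, of 1 "- 1", simplified]
      s02[OF id, of 0 "- 1", simplified]
    by sat+
  show ?thesis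
    unfolding load16_def load12_def
    using k
    by (simp only: z of_bool_eq)
      (cases "orphan (shift 0 2 c)"; cases "orphan (shift 0 (- 2) c)"; cases "orphan (shift 1 2 c)";
        cases "orphan (shift (- 1) 2 c)"; cases "orphan (shift 1 (- 2) c)"; cases
        "orphan (shift (- 1) (- 2) c)"; cases "orphan (shift 3 0 c)"; cases
        "orphan (shift (- 3) 0 c)"; simp)
qed

lemma load16_corner:
  assumes id: "ident c" and h: "c 0 0" "c 1 0" "\<not> c (- 1) 0" "c 0 1" "\<not> c 0 (- 1)"
  shows "load16 c \<le> 3"
proof -
  have z: "\<not> orphan (shift 2 0 c)" "\<not> orphan (shift 0 2 c)" "\<not> orphan (shift 2 1 c)"
    "\<not> orphan (shift 2 (- 1) c)" "\<not> orphan (shift (- 2) (- 1) c)"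
    "\<not> orphan (shift 1 2 c)" "\<not> orphan (shift (- 1) 2 c)"
    "\<not> orphan (shift (- 1) (- 2) c)" "\<not> orphan (shift (- 3) 0 c)"
    "\<not> orphan (shift 0 (- 3) c)"
    using h orphan_shift[of 2 0 c, simplified] orphan_shift[of 0 2 c, simplified]
      orphan_shift[of 2 1 c, simplified]
      orphan_shift[of 2 "- 1" c, simplified] orphan_shift[of "- 2" "- 1" c, simplified]
      orphan_shift[of 1 2 c, simplified] orphan_shift[of "- 1" 2 c, simplified]
      orphan_shift[of "- 1" "- 2" c, simplified] orphan_shift[of "- 3" 0 c, simplified]
      orphan_shift[of 0 "- 3" c, simplified]
    by sat+
  have k: "\<not> (orphan (shift (- 2) 0 c) \<and> orphan (shift 0 (- 2) c))"
    "\<not> (orphan (shift (- 2) 0 c) \<and> orphan (shift (- 2) 1 c))"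
    "\<not> (orphan (shift 0 (- 2) c) \<and> orphan (shift 1 (- 2) c))"
    "\<not> (orphan (shift (- 2) 1 c) \<and> orphan (shift 1 (- 2) c))"
    "\<not> (orphan (shift (- 2) 1 c) \<and> orphan (shift 0 3 c))"
    "\<not> (orphan (shift 1 (- 2) c) \<and> orphan (shift 3 0 c))"
    "\<not> (orphan (shift 3 0 c) \<and> orphan (shift 0 3 c))"
    using h orphan_shift[of "- 2" 0 c, simplified] orphan_shift[of 0 "- 2" c, simplified]
      dom[OF id, of "- 1" "- 1", simplified] orphan_shift[of "- 2" 1 c, simplified]
      orphan_shift[of 1 "- 2" c, simplified] s1m[OF id, of "- 1" 0, simplified]
      orphan_shift[of 0 3 c, simplified] dom[OF id, of "- 1" 2, simplified]
        orphan_shift[of 3 0 c, simplified]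
      dom[OF id, of 2 "- 1", simplified] s1m[OF id, of 1 2, simplified]
    by sat+
  show ?thesis
    unfolding load16_def load12_def
    using k
    by (simp only: z of_bool_eq)
      (cases "orphan (shift (- 2) 0 c)"; cases "orphan (shift 0 (- 2) c)"; cases
        "orphan (shift (- 2) 1 c)"; cases "orphan (shift 1 (- 2) c)"; cases "orphan (shift 3 0 c)";
        cases "orphan (shift 0 3 c)"; simp)
qed

lemma load16_tee:
  assumes id: "ident c" and h: "c 0 0" "c 1 0" "c (- 1) 0" "c 0 1" "\<not> c 0 (- 1)"
  shows "load16 c \<le> 3"
proof -
  have z: "\<not> orphan (shift 2 0 c)" "\<not> orphan (shift (- 2) 0 c)" "\<not> orphan (shift 0 2 c)"
    "\<not> orphan (shift 2 1 c)" "\<not> orphan (shift 2 (- 1) c)"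
    "\<not> orphan (shift (- 2) 1 c)" "\<not> orphan (shift (- 2) (- 1) c)"
    "\<not> orphan (shift 1 2 c)" "\<not> orphan (shift (- 1) 2 c)"
    "\<not> orphan (shift 0 (- 3) c)"
    using h orphan_shift[of 2 0 c, simplified] orphan_shift[of "- 2" 0 c, simplified]
      orphan_shift[of 0 2 c, simplified] orphan_shift[of 2 1 c, simplified]
      orphan_shift[of 2 "- 1" c, simplified] orphan_shift[of "- 2" 1 c, simplified]
      orphan_shift[of "- 2" "- 1" c, simplified] orphan_shift[of 1 2 c, simplified]
      orphan_shift[of "- 1" 2 c, simplified] orphan_shift[of 0 "- 3" c, simplified]
    by sat+
  have k: "\<not> (orphan (shift 0 (- 2) c) \<and> orphan (shift 1 (- 2) c))"
    "\<not> (orphan (shift 0 (- 2) c) \<and> orphan (shift (- 1) (- 2) c))"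
    "\<not> (orphan (shift 1 (- 2) c) \<and> orphan (shift 3 0 c))"
    "\<not> (orphan (shift (- 1) (- 2) c) \<and> orphan (shift (- 3) 0 c))"
    "\<not> (orphan (shift 3 0 c) \<and> orphan (shift 0 3 c))"
    "\<not> (orphan (shift (- 3) 0 c) \<and> orphan (shift 0 3 c))"
    using h orphan_shift[of 0 "- 2" c, simplified] orphan_shift[of 1 "- 2" c, simplified]
      orphan_shift[of "- 1" "- 2" c, simplified] orphan_shift[of 3 0 c, simplified]
      dom[OF id, of 2 "- 1", simplified] orphan_shift[of "- 3" 0 c, simplified]
      dom[OF id, of "- 2" "- 1", simplified] orphan_shift[of 0 3 c, simplified]
        s1m[OF id, of 1 2, simplified]
      s11[OF id, of "- 2" 1, simplified]
    by sat+
  show ?thesis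
    unfolding load16_def load12_def
    using k
    by (simp only: z of_bool_eq)
      (cases "orphan (shift 0 (- 2) c)"; cases "orphan (shift 1 (- 2) c)"; cases
        "orphan (shift (- 1) (- 2) c)"; cases "orphan (shift 3 0 c)"; cases
        "orphan (shift (- 3) 0 c)"; cases "orphan (shift 0 3 c)"; simp)
qed

lemma load16_cross:
  assumes id: "ident c" and h: "c 0 0" "c 1 0" "c (- 1) 0" "c 0 1" "c 0 (- 1)"
  shows "load16 c \<le> 3"
proof -
  have z: "\<not> orphan (shift 2 0 c)" "\<not> orphan (shift (- 2) 0 c)" "\<not> orphan (shift 0 2 c)"
    "\<not> orphan (shift 0 (- 2) c)" "\<not> orphan (shift 2 1 c)"
    "\<not> orphan (shift 2 (- 1) c)" "\<not> orphan (shift (- 2) 1 c)"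
    "\<not> orphan (shift (- 2) (- 1) c)" "\<not> orphan (shift 1 2 c)"
    "\<not> orphan (shift (- 1) 2 c)" "\<not> orphan (shift 1 (- 2) c)"
    "\<not> orphan (shift (- 1) (- 2) c)"
    using h orphan_shift[of 2 0 c, simplified] orphan_shift[of "- 2" 0 c, simplified]
      orphan_shift[of 0 2 c, simplified] orphan_shift[of 0 "- 2" c, simplified]
      orphan_shift[of 2 1 c, simplified] orphan_shift[of 2 "- 1" c, simplified]
      orphan_shift[of "- 2" 1 c, simplified] orphan_shift[of "- 2" "- 1" c, simplified]
      orphan_shift[of 1 2 c, simplified] orphan_shift[of "- 1" 2 c, simplified]
      orphan_shift[of 1 "- 2" c, simplified] orphan_shift[of "- 1" "- 2" c, simplified]
    by sat+
  have k: "\<not> (orphan (shift 3 0 c) \<and> orphan (shift 0 3 c))"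
    "\<not> (orphan (shift 3 0 c) \<and> orphan (shift 0 (- 3) c))"
    "\<not> (orphan (shift (- 3) 0 c) \<and> orphan (shift 0 3 c))"
    "\<not> (orphan (shift (- 3) 0 c) \<and> orphan (shift 0 (- 3) c))"
    using h orphan_shift[of 3 0 c, simplified] orphan_shift[of 0 3 c, simplified]
      s1m[OF id, of 1 2, simplified]
      orphan_shift[of 0 "- 3" c, simplified] s11[OF id, of 1 "- 2", simplified]
      orphan_shift[of "- 3" 0 c, simplified] s11[OF id, of "- 2" 1, simplified]
      s1m[OF id, of "- 2" "- 1", simplified]
    by sat+
  show ?thesis
    unfolding load16_def load12_def
    using k
    by (simp only: z of_bool_eq)
      (cases "orphan (shift 3 0 c)"; cases "orphan (shift (- 3) 0 c)"; cases "orphan (shift 0 3 c)";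
        cases "orphan (shift 0 (- 3) c)"; simp)
qed

text \<open>Orphans on both sides of a single line would leave (0, 1) and (0, -1) with the origin as
  their only codeword. So only the two off-centre offsets of one side remain.\<close>

lemma load12_single_line:
  assumes id: "ident c" and h: "single c" "c 1 0" "c (- 1) 0" "\<not> has_centre c"
  shows "load12 c \<le> 2"
proof -
  have z: "\<not> orphan (shift 2 0 c)" "\<not> orphan (shift (- 2) 0 c)" "\<not> orphan (shift 0 2 c)"
    "\<not> orphan (shift 0 (- 2) c)" "\<not> orphan (shift 2 1 c)"
    "\<not> orphan (shift 2 (- 1) c)" "\<not> orphan (shift (- 2) 1 c)"
    "\<not> orphan (shift (- 2) (- 1) c)"
    using h orphan_shift[of 2 0 c, simplified] orphan_shift[of "- 2" 0 c, simplified]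
      has_centre_def[of c]
      orphan_shift[of 0 2 c, simplified] orphan_shift[of 0 "- 2" c, simplified]
      orphan_shift[of 2 1 c, simplified] orphan_shift[of 2 "- 1" c, simplified]
      orphan_shift[of "- 2" 1 c, simplified] orphan_shift[of "- 2" "- 1" c, simplified]
    by sat+
  have k: "\<not> (orphan (shift 1 2 c) \<and> orphan (shift 1 (- 2) c))"
    "\<not> (orphan (shift 1 2 c) \<and> orphan (shift (- 1) (- 2) c))"
    "\<not> (orphan (shift (- 1) 2 c) \<and> orphan (shift 1 (- 2) c))"
    "\<not> (orphan (shift (- 1) 2 c) \<and> orphan (shift (- 1) (- 2) c))"
    using h single_line[of c, simplified] orphan_shift[of 1 2 c, simplified]
      orphan_shift[of 1 "- 2" c, simplified]
      s02[OF id, of 0 "- 1", simplified] orphan_shift[of "- 1" "- 2" c, simplified]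
      orphan_shift[of "- 1" 2 c, simplified]
    by sat+
  show ?thesis
    unfolding load12_def
    using k
    by (simp only: z of_bool_eq)
      (cases "orphan (shift 1 2 c)"; cases "orphan (shift (- 1) 2 c)"; cases
        "orphan (shift 1 (- 2) c)"; cases "orphan (shift (- 1) (- 2) c)"; simp)
qed

lemma load12_single_corner:
  assumes id: "ident c" and h: "single c" "c 1 0" "c 0 1"
  shows "load12 c \<le> 2"
proof -
  have z: "\<not> orphan (shift 2 0 c)" "\<not> orphan (shift 0 2 c)" "\<not> orphan (shift 2 1 c)"
    "\<not> orphan (shift 2 (- 1) c)" "\<not> orphan (shift (- 2) (- 1) c)"
    "\<not> orphan (shift 1 2 c)" "\<not> orphan (shift (- 1) 2 c)"
    "\<not> orphan (shift (- 1) (- 2) c)"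
    using h orphan_shift[of 2 0 c, simplified] orphan_shift[of 0 2 c, simplified]
      orphan_shift[of 2 1 c, simplified]
      orphan_shift[of 2 "- 1" c, simplified] single_corner[of c, simplified]
      orphan_shift[of "- 2" "- 1" c, simplified] orphan_shift[of 1 2 c, simplified]
      orphan_shift[of "- 1" 2 c, simplified] orphan_shift[of "- 1" "- 2" c, simplified]
    by sat+
  have k: "\<not> (orphan (shift (- 2) 0 c) \<and> orphan (shift 0 (- 2) c))"
    "\<not> (orphan (shift (- 2) 0 c) \<and> orphan (shift (- 2) 1 c))"
    "\<not> (orphan (shift 0 (- 2) c) \<and> orphan (shift 1 (- 2) c))"
    "\<not> (orphan (shift (- 2) 1 c) \<and> orphan (shift 1 (- 2) c))"
    using h single_corner[of c, simplified] orphan_shift[of "- 2" 0 c, simplified]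
      orphan_shift[of 0 "- 2" c, simplified] orphan_shift[of "- 2" 1 c, simplified]
      orphan_shift[of 1 "- 2" c, simplified] s1m[OF id, of "- 1" 0, simplified]
    by sat+
  show ?thesis
    unfolding load12_def
    using k
    by (simp only: z of_bool_eq)
      (cases "orphan (shift (- 2) 0 c)"; cases "orphan (shift 0 (- 2) c)"; cases
        "orphan (shift (- 2) 1 c)"; cases "orphan (shift 1 (- 2) c)"; simp)
qed

text \<open>Up to rotation, the codewords in the cross of a code father form a line, a corner, a tee
  or the full cross.\<close>

lemma load16_le_3:
  assumes id: "ident c" and "c 0 0" "father c"
  shows "load16 c \<le> 3"
proof -
  have *: "load16 d \<le> 3"
    if "ident d" "c' = d \<or> c' = rot d \<or> c' = rot (rot d) \<or> c' = rot (rot (rot d))"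
      "c' 0 0" "c' 1 0" "c' (- 1) 0 \<and> \<not> c' 0 (- 1) \<or> \<not> c' (- 1) 0 \<and> c' 0 1 \<and> \<not> c' 0 (- 1) \<or>
       c' (- 1) 0 \<and> c' 0 1 \<and> c' 0 (- 1)" for d c'
  proof -
    have "ident c'" using that(1,2) by auto
    then have "load16 c' \<le> 3"
      using load16_line[of c'] load16_corner[of c'] load16_tee[of c'] load16_cross[of c'] that(3-)
        by blast
    then show ?thesis using that(2) by auto
  qed
  have "\<exists>c'\<in>{c, rot c, rot (rot c), rot (rot (rot c))}. c' 1 0 \<and> (c' (- 1) 0 \<and> \<not> c' 0 (- 1) \<or>
      \<not> c' (- 1) 0 \<and> c' 0 1 \<and> \<not> c' 0 (- 1) \<or> c' (- 1) 0 \<and> c' 0 1 \<and> c' 0 (- 1))"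
    using assms(2,3) unfolding father_cnf by simp sat
  then show ?thesis
    using *[OF id] assms(2) by fastforce
qed

text \<open>Counterpart of \<open>sval\<close> from the father's point of view: its payments to the
  orphans that have it on their right side.\<close>

definition paid_side :: "(int \<Rightarrow> int \<Rightarrow> bool) \<Rightarrow> nat" where
  "paid_side c = of_bool (orphan (shift (- 2) 0 c)) * side_share c +
     of_bool (orphan (shift (- 2) (- 1) c)) * share c + of_bool (orphan (shift (- 2) 1 c)) * share
       c +
     of_bool (orphan (shift (- 3) 0 c)) * (of_bool (rich c) * share c)"

definition paid :: "(int \<Rightarrow> int \<Rightarrow> bool) \<Rightarrow> nat" where
  "paid c = paid_side c + paid_side (rot c) + paid_side (rot (rot c)) + paid_side
    (rot (rot (rot c)))"

lemma paid_rot [simp]: "paid (rot c) = paid c"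
  by (simp add: paid_def)

text \<open>Every orphan counted by \<open>load16\<close> gets the same share, at most 2 * 3 or 3 *
  2 in total.\<close>

lemma paid_rich:
  assumes "ident c" "rich c"
  shows "paid c \<le> 6"
proof -
  have s: "\<not> single c" and l: "load16 c \<le> 3"
    using assms load16_le_3 by (auto simp: rich_def)
  have "paid c = load16 c * share c"
    using assms(2) s by (simp add: paid_def paid_side_def side_share_def load16_def load12_def
      algebra_simps)
  moreover have "load16 c * share c \<le> 6"
  proof (cases "load16 c \<le> 2")
    case True
    then have "load16 c * 3 \<le> 2 * 3" by (rule mult_le_mono1)
    then show ?thesis using True assms(2) by (simp add: share_def)
  next
    case False
    then show ?thesis using l assms(2) by (simp add: share_def)
  qed
  ultimately show ?thesis by simp
qed

lemma paid_no_centre: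
  assumes "single c" "\<not> has_centre c" "load12 c \<le> 2"
  shows "paid c \<le> 2"
proof -
  have r: "\<not> rich c" using assms(1) by (simp add: rich_def)
  have n: "orphan (shift (- 2) 0 c) \<Longrightarrow> side_share c = share c"
    "orphan (shift 2 0 c) \<Longrightarrow> side_share (rot (rot c)) = share c"
    "orphan (shift 0 (- 2) c) \<Longrightarrow> side_share (rot c) = share c"
    "orphan (shift 0 2 c) \<Longrightarrow> side_share (rot (rot (rot c))) = share c"
    using assms(2) by (auto simp: side_share_def has_centre_def)
  have "paid c = load12 c * share c"
    using r n
    by (cases "orphan (shift (- 2) 0 c)"; cases "orphan (shift 2 0 c)"; cases
      "orphan (shift 0 (- 2) c)";
        cases "orphan (shift 0 2 c)")
      (simp_all add: paid_def paid_side_def load12_def algebra_simps)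
  then show ?thesis
    using assms r by (auto simp: share_def)
qed

lemma paid_single:
  assumes id: "ident c" and s: "single c"
  shows "paid c \<le> 2"
proof -
  have line: "paid d \<le> 2" if "ident d" "single d" "d 1 0" "d (- 1) 0" for d
  proof (cases "has_centre d")
    case False
    then show ?thesis using that paid_no_centre load12_single_line by blast
  next
    case True
    have "\<not> rich d" using that by (simp add: rich_def)
    then have "share d = 0" using True by (simp add: share_def)
    \<comment> \<open>There is only one centre orphan, since (0, 2) and (0, -2) together would make
      the middle of the line redundant. It gets the whole 2, and the share of every other orphan is
      0.\<close>
    moreover have "\<not> orphan (shift 0 2 d) \<or> \<not> orphan (shift 0 (- 2) d)"
      using single_line[OF that(2-4)] orphan_shift[of 0 2 d, simplified]
        orphan_shift[of 0 "- 2" d, simplified]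
      by sat
    ultimately show ?thesis
      using single_line[OF that(2-4)] by (auto simp: paid_def paid_side_def side_share_def)
  qed
  have corner: "paid d \<le> 2" if "ident d" "single d" "d 1 0" "d 0 1" for d
  proof -
    have "\<not> has_centre d"
      using single_corner[OF that(2-4)] by (simp add: has_centre_def)
    then show ?thesis using that paid_no_centre load12_single_corner by blast
  qed
  show ?thesis
    using single_cases[OF s] line[of c] line[of "rot c"] corner[of c] corner[of "rot c"]
      corner[of "rot (rot c)"] corner[of "rot (rot (rot c))"] id s
    by auto
qed

section \<open>What an orphan receives\<close>

text \<open>The other side of the line has no orphan, as in \<open>load12_single_line\<close>; the
  off-centre orphan has the father to itself.\<close>

lemma load12_line_off:
  assumes id: "ident c" and h: "single c" "c 1 0" "c (- 1) 0" "\<not> has_centre c"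
    "orphan (shift (- 1) 2 c)" "\<not> orphan (shift 1 2 c)"
  shows "load12 c \<le> 1"
proof -
  have z: "\<not> orphan (shift 2 0 c)" "\<not> orphan (shift (- 2) 0 c)" "\<not> orphan (shift 0 2 c)"
    "\<not> orphan (shift 0 (- 2) c)" "\<not> orphan (shift 2 1 c)"
    "\<not> orphan (shift 2 (- 1) c)" "\<not> orphan (shift (- 2) 1 c)"
    "\<not> orphan (shift (- 2) (- 1) c)" "\<not> orphan (shift 1 2 c)"
    "\<not> orphan (shift 1 (- 2) c)" "\<not> orphan (shift (- 1) (- 2) c)"
    using h orphan_shift[of 2 0 c, simplified] orphan_shift[of "- 2" 0 c, simplified]
      has_centre_def[of c]
      orphan_shift[of 0 2 c, simplified] orphan_shift[of 0 "- 2" c, simplified]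
      orphan_shift[of 2 1 c, simplified] orphan_shift[of 2 "- 1" c, simplified]
      orphan_shift[of "- 2" 1 c, simplified] orphan_shift[of "- 2" "- 1" c, simplified]
      orphan_shift[of 1 2 c, simplified] single_line[of c, simplified]
        orphan_shift[of "- 1" 2 c, simplified]
      orphan_shift[of 1 "- 2" c, simplified] s02[OF id, of 0 "- 1", simplified]
      orphan_shift[of "- 1" "- 2" c, simplified]
    by sat+
  show ?thesis
    unfolding load12_def

    by (simp only: z of_bool_eq)
      (cases "orphan (shift (- 1) 2 c)"; simp)
qed

lemma father_cases:
  assumes "father c" "c 0 0"
  shows "rich c \<or> single c"
  using assms by (auto simp: rich_def)

lemma share_rich:
  assumes "rich c"
  shows "2 \<le> share c"
  using assms by (simp add: share_def)

lemma share_single: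
  assumes "single c" "\<not> has_centre c"
  shows "1 \<le> share c"
  using assms by (simp add: share_def rich_def)

lemma share_alone:
  assumes "single c" "\<not> has_centre c" "load12 c \<le> 1"
  shows "share c = 2"
  using assms by (simp add: share_def rich_def)

lemma share_le_side_share: "share c \<le> side_share c"
  by (simp add: side_share_def share_def rich_def)

lemma sval_side: "share (shift 2 0 c) \<le> sval c"
  using share_le_side_share[of "shift 2 0 c"] by (simp add: sval_def)

lemma sval_arm: "share (shift 2 1 c) \<le> sval c"
  by (simp add: sval_def)

text \<open>With both arms present, (2, 0) is a father: a rich one pays at least 2, and a single one
  is the middle of a line facing this orphan and pays its 2 units to it.\<close>

lemma sval_central:
  assumes "orphan c" "c 2 1" "c 2 (- 1)"
  shows "2 \<le> sval c"
proof -
  have "father (shift 2 0 c)" "shift 2 0 c 0 0"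
    using assms by (auto simp: father_cnf orphan_def)
  then have "2 \<le> side_share (shift 2 0 c)"
    using father_cases[of "shift 2 0 c"] share_rich[of "shift 2 0 c"]
      share_le_side_share[of "shift 2 0 c"] assms
    by (auto simp: side_share_def)
  then show ?thesis by (simp add: sval_def)
qed

text \<open>(2, 0) and (2, 1) see each other, so separating them needs a third codeword in one of
  their crosses.\<close>

lemma arm_father:
  assumes id: "ident c" and "orphan c" "c 2 1"
  shows "father (shift 2 0 c) \<or> father (shift 2 1 c)"
proof (rule ccontr)
  assume "\<not> ?thesis"
  then have "\<not> father (shift 2 0 c)" "\<not> father (shift 2 1 c)" by simp_all
  then show False
    using assms(2,3) s01[OF id, of 2 0, simplified] orphan_def[of c]
    unfolding not_father_cnf shift_apply arith_simps by simp
qed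

text \<open>A father on the side pays nothing only if it is a single line with a centre orphan. That
  is impossible at (2, 0), and at (2, 1) it is the configuration \<open>Yoff\<close>.\<close>

lemma sval_arm_ge_1:
  assumes id: "ident c" and o: "orphan c" and arm: "c 2 1" "\<not> c 2 (- 1)" and "\<not> Yoff c"
  shows "1 \<le> sval c"
proof -
  have o': "\<not> orphan (shift 0 1 c)"
    using o by (simp add: orphan_def)
  have "1 \<le> share (shift 2 0 c) \<or> 1 \<le> share (shift 2 1 c)"
    using arm_father[OF id o arm(1)]
  proof
    assume f: "father (shift 2 0 c)"
    have "\<not> has_centre (shift 2 0 c)"
      using o arm by (auto simp: has_centre_def orphan_def)
    moreover have "shift 2 0 c 0 0" using o by (simp add: orphan_def)
    ultimately show ?thesis
      using father_cases[OF f] share_rich[of "shift 2 0 c"] share_single[of "shift 2 0 c"] by force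
  next
    assume f: "father (shift 2 1 c)"
    have "shift 2 1 c 0 0" using arm by simp
    moreover have "\<not> has_centre (shift 2 1 c)" if "single (shift 2 1 c)"
      using o o' arm that \<open>\<not> Yoff c\<close> by (auto simp: has_centre_def Yoff_def orphan_def[of c])
    ultimately show ?thesis
      using father_cases[OF f] share_rich[of "shift 2 1 c"] share_single[of "shift 2 1 c"] by force
  qed
  then show ?thesis
    using sval_side[of c] sval_arm[of c] by linarith
qed

text \<open>\<open>Yoff\<close> forces (2, -2) and empties (2, -1), so domination of (1, -1) puts a
  line of three codewords on the lower side. If its middle is single, a centre orphan would make the
  lower side \<open>Yoff\<close> too; without one, the orphan at the origin is its only claimant and
  gets 2.\<close>

lemma sval_below_Yoff:
  assumes id: "ident c" and o: "orphan c" and Y: "Yoff c" and nY: "\<not> Yoff (rot (rot (rot c)))"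
  shows "2 \<le> sval (rot (rot (rot c)))"
proof -
  let ?d = "shift 1 (- 2) c"
  have c22: "c 2 (- 2)" using Yoff_std[OF id o Y] by simp
  have "\<not> c 2 (- 1)"
    using Y single_line[of "rot (shift 2 1 c)"] by (auto simp: Yoff_def)
  then have c12: "c 1 (- 2)"
    using o dom[OF id, of 1 "- 1"] by (simp add: orphan_def)
  have c02: "c 0 (- 2)" using o by (simp add: orphan_def)
  have f: "father ?d" "?d 0 0" using c12 c02 c22 by (auto simp: father_cnf)
  have c21: "c 2 1" using Y by (simp add: Yoff_def single_def)
  have "2 \<le> share ?d"
  proof (cases "rich ?d")
    case True
    then show ?thesis by (rule share_rich)
  next
    case False
    then have s: "single ?d" using father_cases f by blast
    have l: "?d 1 0" "?d (- 1) 0" using c02 c22 by simp_all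
    have o1: "\<not> orphan (shift 1 0 c)" "\<not> orphan (shift 2 0 c)"
      using o c21 orphan_shift[of 2 0 c] by (simp_all add: orphan_def)
    have nc: "\<not> has_centre ?d"
      using nY s c02 c22 o1 single_line[OF s l] by (simp add: has_centre_def Yoff_def)
    have "load12 ?d \<le> 1"
      using load12_line_off[of ?d] id s l nc o o1 by simp
    then show ?thesis using share_alone[OF s nc] by simp
  qed
  then show ?thesis using sval_arm[of "rot (rot (rot c))"] by simp
qed

text \<open>The lower side forces (-2, -2), so the left side has four codewords in a row. Their two
  inner fathers are neighbours, hence rich, and pay 2 each.\<close>

lemma recv_central_Yoff:
  assumes id: "ident c" and o: "orphan c" and l: "c (- 2) 1" "c (- 2) (- 1)" and Y:
    "Yoff (rot (rot (rot c)))"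
  shows "4 \<le> recv c"
proof -
  have c22: "c (- 2) (- 2)" using Yoff_std[of "rot (rot (rot c))"] id o Y by simp
  have c20: "c (- 2) 0" using o by (simp add: orphan_def)
  have "rich (shift (- 2) 0 c)" "rich (shift (- 2) (- 1) c)"
    using c22 c20 l by (auto simp: rich_def single_def father_cnf)
  then have "2 \<le> share (shift (- 2) 0 c)" "2 \<le> share (shift (- 2) (- 1) c)"
    by (auto intro: share_rich)
  then have "4 \<le> sval (rot (rot c))"
    using share_le_side_share[of "rot (rot (shift (- 2) 0 c))"] by (simp add: sval_def)
  then show ?thesis by (simp add: recv_def)
qed

text \<open>The left side gives 2, and the missing right arm forces (1, -2). The lower side gives 2
  if both its arms are present. Otherwise right and lower side give 1 each, or the right side is
  \<open>Yoff\<close> and the lower one makes up for it.\<close>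

lemma recv_central_right_arm:
  assumes id: "ident c" and o: "orphan c" and l: "c (- 2) 1" "c (- 2) (- 1)"
    and r: "c 2 1" "\<not> c 2 (- 1)"
  shows "4 \<le> recv c"
proof (cases "Yoff (rot (rot (rot c))) \<or> c (- 1) (- 2)")
  case True
  then show ?thesis
  proof
    assume "Yoff (rot (rot (rot c)))"
    then show ?thesis using recv_central_Yoff[OF id o l] by simp
  next
    assume b: "c (- 1) (- 2)"
    have "c 1 (- 2)"
      using o r dom[OF id, of 1 "- 1"] by (simp add: orphan_def)
    then have "2 \<le> sval (rot (rot (rot c)))" "2 \<le> sval (rot (rot c))"
      using sval_central[of "rot (rot (rot c))"] sval_central[of "rot (rot c)"] b o l by simp_all
    then show ?thesis by (simp add: recv_def)
  qed
next
  case False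
  have b: "c 1 (- 2)"
    using o r dom[OF id, of 1 "- 1"] by (simp add: orphan_def)
  have "2 \<le> sval (rot (rot c))" using sval_central[of "rot (rot c)"] o l by simp
  moreover have "1 \<le> sval (rot (rot (rot c)))"
    using sval_arm_ge_1[of "rot (rot (rot c))"] id o b False by simp
  moreover have "1 \<le> sval c \<or> 2 \<le> sval (rot (rot (rot c)))"
    using sval_arm_ge_1[OF id o r] sval_below_Yoff[OF id o] False by blast
  ultimately show ?thesis by (auto simp: recv_def)
qed

text \<open>Without any right arm, (1, 2) and (1, -2) are codewords, and upper and lower side give 1
  each unless \<open>recv_central_Yoff\<close> applies.\<close>

lemma recv_central:
  assumes id: "ident c" and o: "orphan c" and l: "c (- 2) 1" "c (- 2) (- 1)"
  shows "4 \<le> recv c"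
proof -
  have L: "2 \<le> sval (rot (rot c))" using sval_central[of "rot (rot c)"] o l by simp
  consider "c 2 1" "c 2 (- 1)" | "c 2 1" "\<not> c 2 (- 1)" | "\<not> c 2 1" "c 2 (- 1)" | "\<not> c 2 1"
    "\<not> c 2 (- 1)"
    by blast
  then show ?thesis
  proof cases
    case 1
    then show ?thesis using L sval_central[OF o] by (simp add: recv_def)
  next
    case 2
    then show ?thesis using recv_central_right_arm[OF id o l] by simp
  next
    case 3
    then show ?thesis using recv_central_right_arm[of "flip c"] id o l by simp
  next
    case 4
    have a: "c 1 (- 2)" "c 1 2"
      using o 4 dom[OF id, of 1 "- 1"] dom[OF id, of 1 1] by (simp_all add: orphan_def)
    have vert: "1 \<le> sval (rot (rot (rot d))) \<or> 4 \<le> recv d"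
      if "ident d" "orphan d" "d (- 2) 1" "d (- 2) (- 1)" "d 1 (- 2)" for d
    proof (cases "d (- 1) (- 2)")
      case True
      then show ?thesis using sval_central[of "rot (rot (rot d))"] that by simp
    next
      case False
      then show ?thesis
        using sval_arm_ge_1[of "rot (rot (rot d))"] recv_central_Yoff[of d] that by auto
    qed
    have "sval (rot (rot (rot (flip c)))) = sval (rot c)"
      using sval_flip[of "rot c"] by (simp add: flip_rot)
    then show ?thesis
      using vert[of c] vert[of "flip c"] a L id o l by (auto simp: recv_def[of c])
  qed
qed

text \<open>A side that gives nothing is \<open>Yoff\<close>; then the next side clockwise gives 2,
  or it is \<open>Yoff\<close> as well and a gift arrives. Four cyclically arranged numbers in which
  every 0 is followed by at least 2 sum to at least 4.\<close>

lemma recv_windmill: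
  assumes id: "ident c" and o: "orphan c" and a: "c 2 1" "c (- 1) 2" "c (- 2) (- 1)" "c 1 (- 2)"
    and n: "\<not> c 2 (- 1)" "\<not> c 1 2" "\<not> c (- 2) 1" "\<not> c (- 1) (- 2)"
  shows "4 \<le> recv c + gifts_in c"
proof -
  have *: "2 \<le> sval (rot (rot (rot d)))"
    if "ident d" "orphan d" "d 2 1" "\<not> d 2 (- 1)" "d (- 1) 2" "sval d = 0" "\<not> gift d" for d
    using sval_arm_ge_1[of d] sval_below_Yoff[of d] that by (auto simp: gift_def)
  have "sval c + of_bool (gift c) = 0 \<Longrightarrow> 2 \<le> sval (rot (rot (rot c)))"
    "sval (rot c) + of_bool (gift (rot c)) = 0 \<Longrightarrow> 2 \<le> sval c"
    "sval (rot (rot c)) + of_bool (gift (rot (rot c))) = 0 \<Longrightarrow> 2 \<le> sval (rot c)"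
    "sval (rot (rot (rot c))) + of_bool (gift (rot (rot (rot c)))) = 0 \<Longrightarrow> 2 \<le> sval (rot (rot c))"
    using *[of c] *[of "rot c"] *[of "rot (rot c)"] *[of "rot (rot (rot c))"] id o a n by simp_all
  then show ?thesis
    unfolding recv_def gifts_in_def by linarith
qed

text \<open>Each of the four diagonal neighbours needs an arm. If no side has two arms, every side
  has exactly one, and the arms form a windmill or its mirror image.\<close>

lemma recv_no_gift:
  assumes id: "ident c" and o: "orphan c"
  shows "4 \<le> recv c + gifts_in c"
proof (cases "c 2 1 \<and> c 2 (- 1) \<or> c (- 2) 1 \<and> c (- 2) (- 1) \<or> c 1 2 \<and> c (- 1) 2 \<or> c 1 (- 2) \<and> c
  (- 1) (- 2)")
  case True
  then have "4 \<le> recv c"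
    using recv_central[of c] recv_central[of "rot c"] recv_central[of "rot (rot c)"]
      recv_central[of "rot (rot (rot c))"] id o by auto
  then show ?thesis by simp
next
  case False
  have "c 2 1 \<or> c 1 2" "c 2 (- 1) \<or> c 1 (- 2)" "c (- 2) 1 \<or> c (- 1) 2"
    "c (- 2) (- 1) \<or> c (- 1) (- 2)"
    using o dom[OF id, of 1 1] dom[OF id, of 1 "- 1"] dom[OF id, of "- 1" 1]
      dom[OF id, of "- 1" "- 1"]
    by (simp_all add: orphan_def)
  then show ?thesis
    using False recv_windmill[OF id o] recv_windmill[of "flip c"] id o by auto
qed

section \<open>Orphans that give a unit away\<close>

lemma gift_outD:
  assumes "gift_out c"
  shows "orphan c" "orphan (shift (- 4) (- 1) c)" "single (shift (- 2) 0 c)" "c (- 2) 1"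
    "c (- 2) (- 1)"
    "single (shift (- 3) (- 3) c)" "c (- 4) (- 3)" "c (- 2) (- 3)" "orphan (shift (- 3) (- 5) c)"
      "c (- 5) 1"
  using assms by (simp_all add: gift_out_def gift_def Yoff_def)

text \<open>(-2, -1) and (-2, -3) are codewords, so (-1, -2) would make (-2, -2) a father beside the
  single line at x = -2; (-1, 2) would do so with (-2, 2). Then only (0, -3) can separate (-2, -4)
  from (-1, -3).\<close>

lemma gift_out_lits:
  assumes id: "ident c" and g: "gift_out c"
  shows "c 0 (- 3)" "\<not> c (- 1) (- 2)" "\<not> c (- 1) 2"
proof -
  note g = gift_outD[OF g]
  show "c 0 (- 3)"
    using g orphan_shift[of "- 4" "- 1" c, simplified] single_line[of "shift (- 3) (- 3) c",
      simplified]
      orphan_shift[of "- 3" "- 5" c, simplified] s11[OF id, of "- 2" "- 4", simplified]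
    by sat

  show "\<not> c (- 1) (- 2)"
    using g single_line[of "rot (shift (- 2) 0 c)", simplified]
      single_line[of "shift (- 3) (- 3) c", simplified]
    by sat

  show "\<not> c (- 1) 2"
    using g single_line[of "rot (shift (- 2) 0 c)", simplified] s1m[OF id, of "- 2" 2, simplified]
    by sat

qed

lemma gift_out_not_flip:
  assumes "gift_out c"
  shows "\<not> gift_out (flip c)"
  using gift_outD(10)[OF assms] gift_outD(2)[of "flip c"] by (auto simp: orphan_def)

text \<open>A gift requires both arms on the side of the donor facing the receiver, which excludes
  upper and lower side. On one side the two mirror-image receivers exclude each other, and the right
  side needs a single line.\<close>

lemma gifts_out_le:
  assumes id: "ident c" and g: "gift_out c"
  shows "gifts_out c \<le> 1 + of_bool (single (shift 2 0 c) \<and> c 2 1 \<and> c 2 (- 1))"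
proof -
  have "\<not> gift_out (rot c)" "\<not> gift_out (rot (rot (rot c)))"
    "\<not> gift_out (rot (flip c))" "\<not> gift_out (rot (rot (rot (flip c))))"
    using gift_out_lits[OF id g] gift_outD(4,5)[of "rot c"] gift_outD(4,5)[of "rot (rot (rot c))"]
      gift_outD(4,5)[of "rot (flip c)"] gift_outD(4,5)[of "rot (rot (rot (flip c)))"] by auto
  moreover have "flip (rot (rot c)) = rot (rot (flip c))"
    by (simp add: flip_rot)
  then have "\<not> gift_out (rot (rot c)) \<or> \<not> gift_out (rot (rot (flip c)))"
    using gift_out_not_flip[of "rot (rot c)"] by auto
  moreover have "single (shift 2 0 c) \<and> c 2 1 \<and> c 2 (- 1)"
    if "gift_out (rot (rot c)) \<or> gift_out (rot (rot (flip c)))"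
    using that gift_outD(3-5)[of "rot (rot c)"] gift_outD(3-5)[of "rot (rot (flip c))"] by auto
  ultimately show ?thesis
    using gift_out_not_flip[OF g] g by (auto simp: gifts_out_def)
qed

lemma gift_out_sval_left:
  assumes "gift_out c"
  shows "2 \<le> sval (rot (rot c))"
  using sval_central[of "rot (rot c)"] gift_outD[OF assms] by simp

text \<open>Were the upper side of the kind \<open>Yoff\<close>, then (-1, 2) and (0, 3) would not
  be separated.\<close>

lemma gift_out_top_arm:
  assumes id: "ident c" and g: "gift_out c" and t: "c 1 2"
  shows "1 \<le> sval (rot c)"
proof -
  note g' = gift_outD[OF g]
  have "\<not> Yoff (flip (rot c))"
  proof
    assume "Yoff (flip (rot c))"
    then have Y: "c 0 2" "c 2 2" "single (shift 1 2 c)" "orphan (shift 1 4 c)"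
      by (simp_all add: Yoff_def)
    then show False
      using g' t single_line[of "rot (shift (- 2) 0 c)", simplified]
        orphan_shift[of 1 4 c, simplified]
      single_line[of "shift 1 2 c", simplified] s11[OF id, of "- 1" 2, simplified]
      by sat
  qed
  then have "1 \<le> sval (flip (rot c))"
    using sval_arm_ge_1[of "flip (rot c)"] id g'(1) t gift_out_lits(3)[OF id g] by simp
  then show ?thesis by simp
qed

text \<open>The codewords (0, -3), (0, -2), (1, -2) make (0, -2) a father. If it is single, it is a
  corner, and all other offsets of its load are excluded, so the donor gets 2.\<close>

lemma gift_out_bottom_arm:
  assumes id: "ident c" and g: "gift_out c" and b: "c 1 (- 2)"
  shows "2 \<le> sval (rot (rot (rot c)))"
proof -
  let ?d = "shift 0 (- 2) c"
  note g' = gift_outD[OF g]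
  have l: "?d 0 0" "?d 1 0" "?d 0 (- 1)" "\<not> ?d (- 1) 0" "\<not> ?d 0 1"
    using g'(1) b gift_out_lits[OF id g] by (simp_all add: orphan_def)
  then have f: "father ?d" by (auto simp: father_cnf)
  have "2 \<le> share ?d"
  proof (cases "rich ?d")
    case True
    then show ?thesis by (rule share_rich)
  next
    case False
    then have s: "single ?d" using father_cases f l by blast
    have nc: "\<not> has_centre ?d"
      using l by (simp add: has_centre_def)
    have z: "\<not> orphan (shift 2 (- 2) c)" "\<not> orphan (shift (- 2) (- 2) c)"
      "\<not> orphan (shift 0 (- 4) c)" "\<not> orphan (shift 2 (- 1) c)"
      "\<not> orphan (shift 2 (- 3) c)" "\<not> orphan (shift (- 2) (- 1) c)"
      "\<not> orphan (shift (- 2) (- 3) c)" "\<not> orphan (shift 1 0 c)"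
      "\<not> orphan (shift (- 1) 0 c)" "\<not> orphan (shift 1 (- 4) c)"
      "\<not> orphan (shift (- 1) (- 4) c)"
      using g' b s l[simplified] orphan_shift[of 2 "- 2" c, simplified]
        orphan_shift[of "- 4" "- 1" c, simplified]
        orphan_shift[of "- 2" "- 2" c, simplified]
        single_corner[of "rot (rot (rot (shift 0 (- 2) c)))", simplified]
          orphan_shift[of 0 "- 4" c, simplified]
        orphan_shift[of 2 "- 1" c, simplified] orphan_shift[of 2 "- 3" c, simplified]
          orphan_def[of c]
        orphan_shift[of "- 2" "- 1" c, simplified] orphan_shift[of "- 3" "- 5" c, simplified]
        orphan_shift[of "- 2" "- 3" c, simplified] orphan_shift[of 1 0 c, simplified]
        orphan_shift[of "- 1" 0 c, simplified] orphan_shift[of 1 "- 4" c, simplified]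
        orphan_shift[of "- 1" "- 4" c, simplified]
      by sat+
    have "load12 ?d \<le> 1"
      by (simp add: load12_def z)
    then show ?thesis using share_alone[OF s nc] by simp
  qed
  then show ?thesis using sval_side[of "rot (rot (rot c))"] by simp
qed

text \<open>Here the payment comes from straight distance 3: separating (0, -3) from (0, -2) makes
  (0, -3) a father, and no line or corner through it can be single.\<close>

lemma gift_out_rich_below:
  assumes id: "ident c" and g: "gift_out c" and b: "\<not> c 1 (- 2)" "c 2 (- 1)" and nf:
    "\<not> father (shift 3 (- 1) c)"
  shows "2 \<le> sval (rot (rot (rot c)))"
proof -
  let ?d = "shift 0 (- 3) c"
  note g' = gift_outD[OF g]
  note nf' = nf[unfolded not_father_cnf, simplified]
  note c03 = gift_out_lits(1)[OF id g]
  have l: "c 0 (- 3)" "c 0 (- 2)"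
    using g' b orphan_def[of c] single_line[of "shift (- 3) (- 3) c", simplified]
      s10[OF id, of "- 1" "- 2", simplified]
    by sat+
  have l3: "c 1 (- 3) \<or> c (- 1) (- 3) \<or> c 0 (- 4)"
    using g' b orphan_def[of c] orphan_shift[of "- 4" "- 1" c, simplified]
      single_line[of "shift (- 3) (- 3) c", simplified] s01[OF id, of 0 "- 3", simplified]
    by sat
  have "\<not> single ?d"
  proof
    assume s: "single ?d"
    show False
      using g' b l s single_cases[OF s, simplified] orphan_def[of c] nf'
        single_corner[of "shift 0 (- 3) c", simplified] s11[OF id, of 2 "- 2", simplified]
        s1m[OF id, of 1 "- 1", simplified] single_line[of "shift (- 3) (- 3) c", simplified]
        single_corner[of "rot (shift 0 (- 3) c)", simplified]
          orphan_shift[of "- 3" "- 5" c, simplified]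
        single_corner[of "rot (rot (shift 0 (- 3) c))", simplified]
        single_corner[of "rot (rot (rot (shift 0 (- 3) c)))", simplified]
        single_line[of "shift 0 (- 3) c", simplified] single_line[of "rot (shift 0 (- 3) c)",
          simplified]
        s1m[OF id, of "- 1" "- 4", simplified]
      by sat
  qed
  then have "rich ?d"
    using l l3 by (auto simp: rich_def father_cnf)
  then show ?thesis
    using share_rich[of ?d] by (simp add: sval_def)
qed

text \<open>The father (3, -1) next to the arm (2, -1) makes (2, 0) rich. Either an arm is a second
  rich father, or at most two orphans claim from (2, 0), so that it pays 3 instead of 2.\<close>

lemma gift_out_right_central_rich:
  assumes id: "ident c" and g: "gift_out c" and b: "\<not> c 1 (- 2)" "c 2 (- 1)" "c 2 1" and f:
    "father (shift 3 (- 1) c)"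
  shows "3 \<le> sval c"
proof -
  let ?d = "shift 2 0 c"
  note g' = gift_outD[OF g]
  have c20: "c 2 0" using g'(1) by (simp add: orphan_def)
  have fd: "father ?d" using b c20 by (auto simp: father_cnf)
  have "\<not> single ?d"
    using b f by (simp add: single_def)
  then have r: "rich ?d" using fd c20 by (simp add: rich_def)
  then have d2: "2 \<le> side_share ?d"
    using share_rich share_le_side_share order_trans by blast
  show ?thesis
  proof (cases "father (shift 2 1 c) \<or> father (shift 2 (- 1) c)")
    case True
    then have "rich (shift 2 1 c) \<or> rich (shift 2 (- 1) c)"
      using b c20 fd by (auto simp: rich_def single_def)
    then have "2 \<le> share (shift 2 1 c) + share (shift 2 (- 1) c)"
      using share_rich[of "shift 2 1 c"] share_rich[of "shift 2 (- 1) c"] by linarith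
    then show ?thesis using d2 by (simp add: sval_def)
  next
    case False
    then have n1: "\<not> father (shift 2 1 c)" and n2: "\<not> father (shift 2 (- 1) c)" by simp_all
    note n' = n1[unfolded not_father_cnf, simplified] n2[unfolded not_father_cnf, simplified]
    note f' = f[unfolded father_cnf, simplified]
    have z: "\<not> orphan (shift 4 0 c)" "\<not> orphan (shift 2 2 c)" "\<not> orphan (shift 2 (- 2) c)"
      "\<not> orphan (shift 4 (- 1) c)" "\<not> orphan (shift 0 1 c)"
      "\<not> orphan (shift 0 (- 1) c)" "\<not> orphan (shift 3 2 c)" "\<not> orphan (shift 1 2 c)"
      "\<not> orphan (shift 3 (- 2) c)" "\<not> orphan (shift 1 (- 2) c)"
      "\<not> orphan (shift (- 1) 0 c)" "\<not> orphan (shift 2 (- 3) c)"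
      using g' b f' orphan_shift[of 4 0 c, simplified] orphan_shift[of 2 2 c, simplified]
        orphan_shift[of 2 "- 2" c, simplified] orphan_shift[of 4 "- 1" c, simplified]
          orphan_def[of c]
        orphan_shift[of 0 1 c, simplified] orphan_shift[of 0 "- 1" c, simplified]
        orphan_shift[of 3 2 c, simplified] orphan_shift[of 1 2 c, simplified]
        orphan_shift[of 3 "- 2" c, simplified] orphan_shift[of 1 "- 2" c, simplified]
        orphan_shift[of "- 1" 0 c, simplified] single_line[of "shift (- 3) (- 3) c", simplified]
        orphan_shift[of 2 "- 3" c, simplified] s20[OF id, of "- 1" "- 2", simplified] n'
      by sat+
    have k: "\<not> (orphan (shift 4 1 c) \<and> orphan (shift 5 0 c))"
      "\<not> (orphan (shift 4 1 c) \<and> orphan (shift 2 3 c))"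
      "\<not> (orphan (shift 5 0 c) \<and> orphan (shift 2 3 c))"
      using g' b orphan_shift[of 4 1 c, simplified] orphan_shift[of 5 0 c, simplified]
        orphan_shift[of 2 3 c, simplified]
        dom[OF id, of 3 2, simplified] s1m[OF id, of 3 2, simplified] n'
      by sat+
    have "load16 ?d \<le> 2"
      using k by (simp add: load16_def load12_def z)
    then have "share ?d = 3"
      using r by (simp add: share_def)
    then show ?thesis
      using share_le_side_share[of ?d] by (simp add: sval_def)
  qed
qed

text \<open>The left side gives 2, and the other sides give 3, or 4 when the right side is a single
  line with both arms, the only case of two gifts.\<close>

lemma gift_out_recv:
  assumes id: "ident c" and g: "gift_out c"
  shows "4 + gifts_out c \<le> recv c"
proof -
  note o = gift_outD(1)[OF g]
  note L = gift_out_sval_left[OF g] and top = gift_out_top_arm[OF id g]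
  note n = gift_out_lits(2,3)[OF id g]
  have corner: "c 2 (- 1) \<or> c 1 (- 2)" "c 2 1 \<or> c 1 2"
    using o dom[OF id, of 1 "- 1"] dom[OF id, of 1 1] by (simp_all add: orphan_def)
  have central: "2 \<le> sval c" if "c 2 1" "c 2 (- 1)"
    using sval_central[OF o that] .
  have g2: "gifts_out c \<le> 2"
    using gifts_out_le[OF id g] by (auto simp: of_bool_def split: if_splits)
  show ?thesis
  proof (cases "c 1 (- 2)")
    case b: True
    have B: "2 \<le> sval (rot (rot (rot c)))" using gift_out_bottom_arm[OF id g b] .
    consider "c 2 1" "c 2 (- 1)" | "c 1 2" "\<not> (c 2 1 \<and> c 2 (- 1))" | "c 2 1" "\<not> c 2 (- 1)"
      using corner by blast
    then show ?thesis
    proof cases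
      case 1
      then show ?thesis using L B central g2 by (simp add: recv_def)
    next
      case 2
      then show ?thesis using L B top gifts_out_le[OF id g] by (auto simp add: recv_def)
    next
      case 3
      have "1 \<le> sval c \<or> 4 \<le> sval (rot (rot (rot c)))"
      proof (cases "Yoff c")
        case False
        then show ?thesis using sval_arm_ge_1[OF id o 3] by simp
      next
        case True
        \<comment> \<open>The right side is useless, but the lower one then has the path (0, -3),
          (0, -2), (1, -2), (2, -2) with two adjacent code fathers.\<close>
        have c22: "c 2 (- 2)" using Yoff_std[OF id o True] by simp
        have c02: "c 0 (- 2)" using o by (simp add: orphan_def)
        have "rich (shift 0 (- 2) c)" "rich (shift 1 (- 2) c)"
          using c22 c02 b gift_out_lits(1)[OF id g] by (auto simp: rich_def single_def father_cnf)
        then have "2 \<le> share (shift 0 (- 2) c)" "2 \<le> share (shift 1 (- 2) c)"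
          by (auto intro: share_rich)
        then show ?thesis
          using share_le_side_share[of "rot (rot (rot (shift 0 (- 2) c)))"] by (simp add: sval_def)
      qed
      then show ?thesis using L B 3 gifts_out_le[OF id g] by (auto simp add: recv_def)
    qed
  next
    case b: False
    then have r: "c 2 (- 1)" using corner by simp
    show ?thesis
    proof (cases "father (shift 3 (- 1) c)")
      case False
      then have B: "2 \<le> sval (rot (rot (rot c)))" using gift_out_rich_below[OF id g b r] by simp
      show ?thesis
      proof (cases "c 2 1")
        case True
        then show ?thesis using L B central r g2 by (simp add: recv_def)
      next
        case False
        then show ?thesis using L B top corner gifts_out_le[OF id g] by (simp add: recv_def)
      qed
    next
      case f: True
      show ?thesis
      proof (cases "c 2 1")
        case True
        have "\<not> single (shift 2 0 c)" using f r by (simp add: single_def)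
        then show ?thesis
          using L gift_out_right_central_rich[OF id g b r True f] gifts_out_le[OF id g] by
            (simp add: recv_def)
      next
        case False
        have "father (shift 2 0 c) \<or> father (shift 2 (- 1) c)"
          using arm_father[of "flip c"] id o r by simp
        then have "rich (shift 2 0 c) \<or> rich (shift 2 (- 1) c)"
          using f r o by (auto simp: rich_def single_def orphan_def[of c])
        then have "2 \<le> sval c"
          using share_rich[of "shift 2 0 c"] share_rich[of "shift 2 (- 1) c"]
            share_le_side_share[of "shift 2 0 c"] unfolding sval_def by linarith
        then show ?thesis using L top corner False gifts_out_le[OF id g] by (simp add: recv_def)
      qed
    qed
  qed
qed

text \<open>An orphan that gives lives on its fathers alone; the eight orientations reduce to
  \<open>gift_out_recv\<close>.\<close>

theorem recv_ge:
  assumes id: "ident c" and o: "orphan c"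
  shows "4 + gifts_out c \<le> recv c + gifts_in c"
proof (cases "gifts_out c = 0")
  case True
  then show ?thesis using recv_no_gift[OF id o] by simp
next
  case False
  have *: "4 + gifts_out c \<le> recv c"
    if "gift_out d" "ident d" "recv d = recv c" "gifts_out d = gifts_out c" for d
    using gift_out_recv[OF that(2,1)] that(3,4) by simp
  from False have "gift_out c \<or> gift_out (rot c) \<or> gift_out (rot (rot c)) \<or> gift_out
    (rot (rot (rot c))) \<or>
    gift_out (flip c) \<or> gift_out (rot (flip c)) \<or> gift_out (rot (rot (flip c))) \<or>
    gift_out (rot (rot (rot (flip c))))"
    unfolding gifts_out_def by (rule contrapos_np) simp
  then have "4 + gifts_out c \<le> recv c"
    by (elim disjE) (erule *; simp add: id)+
  then show ?thesis by simp
qed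

section \<open>Double counting for identifying codes\<close>

definition sum5 :: "((int \<Rightarrow> int \<Rightarrow> bool) \<Rightarrow> nat) \<Rightarrow> (int \<Rightarrow> int \<Rightarrow> bool) \<Rightarrow> nat" where
  "sum5 F c = F c + F (shift 1 0 c) + F (shift (- 1) 0 c) + F (shift 0 1 c) + F (shift 0 (- 1) c)"

definition code_fathers :: "(int \<Rightarrow> int \<Rightarrow> bool) \<Rightarrow> nat" where
  "code_fathers = sum5 (\<lambda>c. of_bool (c 0 0 \<and> father c))"

definition free_fathers :: "(int \<Rightarrow> int \<Rightarrow> bool) \<Rightarrow> nat" where
  "free_fathers = sum5 (\<lambda>c. of_bool (\<not> c 0 0 \<and> father c))"

text \<open>
  The amount that each code father pays to a codeword in its cross; a father outside the code
  always pays 4.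
\<close>

definition need :: "(int \<Rightarrow> int \<Rightarrow> bool) \<Rightarrow> nat" where
  "need c = (if redundant c \<or> 0 < free_fathers c then 0 else if 2 \<le> code_fathers c then 2 else 4)"

definition upkeep :: "(int \<Rightarrow> int \<Rightarrow> bool) \<Rightarrow> nat" where
  "upkeep = sum5 (\<lambda>c. of_bool (c 0 0) * need c)"

text \<open>\<open>spent\<close> books the payments within crosses with the father,
  \<open>earned\<close> books the same payments with the codeword.\<close>

definition spent :: "(int \<Rightarrow> int \<Rightarrow> bool) \<Rightarrow> nat" where
  "spent c = of_bool (father c) * (if c 0 0 then upkeep c else 4 * weight c)"

definition earned :: "(int \<Rightarrow> int \<Rightarrow> bool) \<Rightarrow> nat" where
  "earned c = of_bool (c 0 0) * (4 * free_fathers c + code_fathers c * need c)"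

lemma sum5_rot: "(\<And>d. F (rot d) = F d) \<Longrightarrow> sum5 F (rot c) = sum5 F c"
  by (simp add: sum5_def)

lemma need_rot [simp]: "need (rot c) = need c"
  by (simp add: need_def code_fathers_def free_fathers_def sum5_rot)

lemma upkeep_rot [simp]: "upkeep (rot c) = upkeep c"
  by (simp add: upkeep_def sum5_rot)

lemma need_le: "need c \<le> 4"
  by (simp add: need_def)

lemma need_redundant: "redundant c \<Longrightarrow> need c = 0"
  by (simp add: need_def)

lemma need_free:
  assumes "father c \<and> \<not> c 0 0 \<or> father (shift 1 0 c) \<and> \<not> c 1 0 \<or> father (shift (- 1) 0 c) \<and> \<not> c
    (- 1) 0 \<or>
    father (shift 0 1 c) \<and> \<not> c 0 1 \<or> father (shift 0 (- 1) c) \<and> \<not> c 0 (- 1)"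
  shows "need c = 0"
  using assms by (auto simp: need_def free_fathers_def sum5_def)

lemma need_two_fathers:
  assumes "father c" "c 0 0" "father (shift 1 0 c)" "c 1 0"
  shows "need c \<le> 2" "need (shift 1 0 c) \<le> 2"
  using assms by (simp_all add: need_def code_fathers_def sum5_def)

lemma upkeep_le: "upkeep c \<le> 4 * weight c"
proof -
  have "of_bool b * need d \<le> 4 * of_bool b" for b d
    using need_le[of d] by simp
  then show ?thesis
    unfolding upkeep_def sum5_def weight_def by (simp add: add_mono)
qed

lemma upkeep_right:
  assumes "c 0 0" "weight c = 3"
  shows "upkeep c + 4 * of_bool (c 1 0) \<le> 8 + need c + of_bool (c 1 0) * need (shift 1 0 c)"
  using assms need_le[of "shift (- 1) 0 c"] need_le[of "shift 0 1 c"] need_le[of "shift 0 (- 1) c"]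
  by (auto simp: upkeep_def sum5_def weight3)

text \<open>Each defect of singleness saves 4 of the 12 units: a codeword with need 0 saves 4, and
  two adjacent code fathers save 2 on each of themselves.\<close>

lemma upkeep_shared:
  assumes c: "c 0 0" "weight c = 3"
    and v: "redundant c \<or> father (shift 1 0 c) \<or> c 1 0 \<and> (redundant (shift 1 0 c) \<or>
      father (shift 2 0 c) \<or> father (shift 1 1 c) \<or> father (shift 1 (- 1) c))"
  shows "upkeep c \<le> 8"
proof -
  have f: "father c" using c by (simp add: father_def)
  consider "need c = 0" | "c 1 0" "father (shift 1 0 c)" | "c 1 0" "need (shift 1 0 c) = 0"
  proof -
    \<comment> \<open>A father beyond (1, 0) that is itself a codeword makes (1, 0) a father, which
      leads to the second case.\<close>
    have "father (shift 1 0 c)" if "c 1 0" "c 2 0 \<or> c 1 1 \<or> c 1 (- 1)"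
      using that c by (auto simp: father_cnf)
    moreover have "need c = 0" if "redundant c \<or> father (shift 1 0 c) \<and> \<not> c 1 0"
      using that need_free[of c] need_redundant[of c] by auto
    moreover have "need (shift 1 0 c) = 0" if "redundant (shift 1 0 c) \<or>
      father (shift 2 0 c) \<and> \<not> c 2 0 \<or> father (shift 1 1 c) \<and> \<not> c 1 1 \<or> father (shift 1 (- 1) c) \<and> \<not>
        c 1 (- 1)"
      using that need_free[of "shift 1 0 c"] need_redundant[of "shift 1 0 c"] by auto
    ultimately show thesis using v that by blast
  qed
  then show ?thesis
  proof cases
    case 1
    then show ?thesis using upkeep_right[OF c] need_le[of "shift 1 0 c"] by (cases "c 1 0") auto
  next
    case 2
    then show ?thesis using upkeep_right[OF c] need_two_fathers[OF f c(1)] by simp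
  next
    case 3
    then show ?thesis using upkeep_right[OF c] need_le[of c] by simp
  qed
qed

text \<open>For weight w at least 4, 4 w + 6 is at most 14 (w - 2); for weight 3 the bound is 8 + 6
  = 14.\<close>

lemma upkeep_rich:
  assumes "rich c"
  shows "upkeep c + 6 \<le> 14 * (weight c - 2)"
proof (cases "weight c = 3")
  case False
  then have "4 \<le> weight c" using assms by (simp add: rich_def father_def)
  then show ?thesis using upkeep_le[of c] by linarith
next
  case True
  have c: "c 0 0" using assms by (simp add: rich_def)
  have "upkeep c \<le> 8"
    using assms c True upkeep_shared[of c] upkeep_shared[of "rot c"] upkeep_shared[of "rot (rot c)"]
      upkeep_shared[of "rot (rot (rot c))"]
    unfolding rich_def single_def by (simp; blast)
  then show ?thesis using True by simp
qed

lemma not_father_share: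
  assumes "\<not> (father c \<and> c 0 0)"
  shows "share c = 0" "side_share c = 0" "paid c = 0"
proof -
  have "\<not> rich c" "\<not> single c"
    using assms by (auto simp: rich_def single_def father_def)
  then show "share c = 0" "side_share c = 0" "paid c = 0"
    by (simp_all add: paid_def paid_side_def share_def side_share_def)
qed

lemma spent_le:
  assumes "ident c"
  shows "spent c + paid c \<le> 14 * (weight c - 2)"
proof (cases "father c \<and> c 0 0")
  case True
  then consider "rich c" | "single c" using father_cases by blast
  then show ?thesis
  proof cases
    case 1
    then show ?thesis using upkeep_rich[OF 1] paid_rich[OF assms 1] True by (simp add: spent_def)
  next
    case 2
    then have "weight c = 3" by (simp add: single_def)
    then show ?thesis using upkeep_le[of c] paid_single[OF assms 2] True by (simp add: spent_def)
  qed
next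
  case False
  have "weight c \<le> 4" if "\<not> c 0 0"
    using that by (auto simp: weight_def of_bool_def)
  then show ?thesis
    using False not_father_share[OF False] by (auto simp: spent_def father_def)
qed

lemma earned_ge:
  assumes "ident c" "c 0 0" "\<not> redundant c" "\<not> orphan c"
  shows "4 \<le> earned c"
proof (cases "0 < free_fathers c")
  case True
  then show ?thesis using assms by (simp add: earned_def)
next
  case False
  have "father c \<or> father (shift 1 0 c) \<or> father (shift (- 1) 0 c) \<or> father (shift 0 1 c) \<or> father
    (shift 0 (- 1) c)"
    using orphan_or_father assms by blast
  then have "0 < code_fathers c"
    using False by (auto simp: free_fathers_def code_fathers_def sum5_def)
  then have "4 \<le> code_fathers c * need c"
    using False assms by (auto simp: need_def)
  then show ?thesis using assms by (simp add: earned_def)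
qed

lemma gifts_orphan:
  assumes "\<not> orphan c"
  shows "gifts_in c = 0" "gifts_out c = 0"
proof -
  have g: "\<not> gift d" "\<not> gift_out d" if "\<not> orphan d" for d
    using that gift_outD(1) by (auto simp: gift_def)
  show "gifts_in c = 0" "gifts_out c = 0"
    using assms by (simp_all add: gifts_in_def gifts_out_def g)
qed

lemma budget:
  assumes "ident c"
  shows "4 * of_bool (c 0 0) + gifts_out c \<le>
    earned c + of_bool (orphan c) * recv c + gifts_in c + 14 * of_bool (redundant c)"
proof (cases "orphan c")
  case True
  then show ?thesis using recv_ge[OF assms True] by (simp add: orphan_def)
next
  case False
  then show ?thesis
    using earned_ge[OF assms] gifts_orphan by (cases "c 0 0"; cases "redundant c")
      (auto simp: redundant_def)
qed

text \<open>Two vertices of the cross that see nothing but the codeword would not be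
  separated.\<close>

lemma private_unique:
  assumes id: "ident c" and "c 0 0"
  shows "sum5 (\<lambda>d. of_bool (weight d = 1)) c + of_bool (redundant c) = 1"
proof -
  let ?p = "\<lambda>i j. weight (shift i j c) = 1"
  have w: "?p 0 0 \<longleftrightarrow> \<not> c 1 0 \<and> \<not> c (- 1) 0 \<and> \<not> c 0 1 \<and> \<not> c 0 (- 1)"
    "?p 1 0 \<longleftrightarrow> \<not> c 1 0 \<and> \<not> c 2 0 \<and> \<not> c 1 1 \<and> \<not> c 1 (- 1)"
    "?p (- 1) 0 \<longleftrightarrow> \<not> c (- 1) 0 \<and> \<not> c (- 2) 0 \<and> \<not> c (- 1) 1 \<and> \<not> c (- 1) (- 1)"
    "?p 0 1 \<longleftrightarrow> \<not> c 0 1 \<and> \<not> c 0 2 \<and> \<not> c 1 1 \<and> \<not> c (- 1) 1"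
    "?p 0 (- 1) \<longleftrightarrow> \<not> c 0 (- 1) \<and> \<not> c 0 (- 2) \<and> \<not> c 1 (- 1) \<and> \<not> c (- 1) (- 1)"
    using assms(2) by (auto simp: weight_def)
  have "\<not> (?p 0 0 \<and> ?p 1 0)" "\<not> (?p 0 0 \<and> ?p (- 1) 0)" "\<not> (?p 0 0 \<and> ?p 0 1)"
    "\<not> (?p 0 0 \<and> ?p 0 (- 1))"
    "\<not> (?p 1 0 \<and> ?p (- 1) 0)" "\<not> (?p 1 0 \<and> ?p 0 1)" "\<not> (?p 1 0 \<and> ?p 0 (- 1))"
    "\<not> (?p (- 1) 0 \<and> ?p 0 1)" "\<not> (?p (- 1) 0 \<and> ?p 0 (- 1))" "\<not> (?p 0 1 \<and> ?p 0 (- 1))"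
    unfolding w
    using s10[OF id, of 0 0, simplified] s10[OF id, of "- 1" 0, simplified]
      s01[OF id, of 0 0, simplified]
      s01[OF id, of 0 "- 1", simplified] s20[OF id, of "- 1" 0, simplified]
        s02[OF id, of 0 "- 1", simplified]
      s1m[OF id, of 0 1, simplified] s11[OF id, of 0 "- 1", simplified]
        s11[OF id, of "- 1" 0, simplified]
      s1m[OF id, of "- 1" 0, simplified]
    by sat+
  then show ?thesis
    using assms(2) unfolding sum5_def redundant_def shift_0
    by (cases "?p 0 0"; cases "?p 1 0"; cases "?p (- 1) 0"; cases "?p 0 1"; cases "?p 0 (- 1)") auto
qed

section \<open>Sums over one period of the unrolled code\<close>

definition unroll :: "int \<Rightarrow> int \<Rightarrow> int set \<Rightarrow> int \<Rightarrow> int \<Rightarrow> int \<Rightarrow> bool" where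
  "unroll n d C v = (\<lambda>i j. (v + i + d * j) mod n \<in> C)"

lemma shift_unroll: "shift a b (unroll n d C v) = unroll n d C (v + (a + d * b))"
  by (simp add: unroll_def shift_def algebra_simps)

lemma unroll_mod: "unroll n d C (v mod n) = unroll n d C v"
  by (simp add: unroll_def mod_add_left_eq add.assoc)

definition torus_sum :: "int \<Rightarrow> int \<Rightarrow> int set \<Rightarrow> ((int \<Rightarrow> int \<Rightarrow> bool) \<Rightarrow> nat) \<Rightarrow> nat" where
  "torus_sum n d C F = (\<Sum>v\<in>{0..<n}. F (unroll n d C v))"

lemma sum_periodic_shift:
  fixes g :: "int \<Rightarrow> nat"
  assumes "\<And>v. g (v mod n) = g v" "0 < n"
  shows "(\<Sum>v\<in>{0..<n}. g (v + t)) = (\<Sum>v\<in>{0..<n}. g v)"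
proof -
  have "bij_betw (\<lambda>v. (v + t) mod n) {0..<n} {0..<n}"
    by (rule bij_betw_byWitness[where f' = "\<lambda>v. (v - t) mod n"])
      (use assms(2) in \<open>auto simp: mod_simps\<close>)
  then have "(\<Sum>v\<in>{0..<n}. g ((v + t) mod n)) = (\<Sum>v\<in>{0..<n}. g v)"
    by (rule sum.reindex_bij_betw)
  then show ?thesis using assms(1) by simp
qed

lemma torus_sum_shift:
  assumes "0 < n"
  shows "torus_sum n d C (\<lambda>c. F (shift a b c)) = torus_sum n d C F"
  unfolding torus_sum_def shift_unroll
  by (rule sum_periodic_shift[of "\<lambda>v. F (unroll n d C v)"]) (use assms in \<open>auto simp: unroll_mod\<close>)

lemma torus_sum_add: "torus_sum n d C (\<lambda>c. F c + G c) = torus_sum n d C F + torus_sum n d C G"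
  by (simp add: torus_sum_def sum.distrib)

lemma torus_sum_mult: "torus_sum n d C (\<lambda>c. k * F c) = k * torus_sum n d C F"
  by (simp add: torus_sum_def sum_distrib_left)

lemma torus_sum_mono:
  assumes "\<And>v. F (unroll n d C v) \<le> G (unroll n d C v)"
  shows "torus_sum n d C F \<le> torus_sum n d C G"
  using assms by (simp add: torus_sum_def sum_mono)

text \<open>The double counting principle: translation by (-a, -b) turns a sum over payers into a
  sum over receivers.\<close>

lemma torus_sum_exchange:
  assumes "0 < n"
  shows "torus_sum n d C (\<lambda>c. H c (shift a b c)) = torus_sum n d C (\<lambda>c. H (shift (- a) (- b) c) c)"
  using torus_sum_shift[OF assms, of d C "\<lambda>c. H (shift (- a) (- b) c) c" a b] by simp

lemma torus_sum_sum5: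
  assumes "0 < n"
  shows "torus_sum n d C (\<lambda>c. sum5 (\<lambda>e. H c e) c) = torus_sum n d C (\<lambda>c. sum5 (\<lambda>e. H e c) c)"
  unfolding sum5_def torus_sum_add
  using torus_sum_exchange[OF assms, of d C H 1 0] torus_sum_exchange[OF assms, of d C H "- 1" 0]
    torus_sum_exchange[OF assms, of d C H 0 1] torus_sum_exchange[OF assms, of d C H 0 "- 1"]
  by simp

lemma torus_sum_spent:
  assumes "0 < n"
  shows "torus_sum n d C spent = torus_sum n d C earned"
proof -
  \<comment> \<open>\<open>H c e\<close> is what the father at the origin of \<open>c\<close> pays
    to the codeword at the origin of \<open>e\<close>.\<close>
  define H :: "(int \<Rightarrow> int \<Rightarrow> bool) \<Rightarrow> (int \<Rightarrow> int \<Rightarrow> bool) \<Rightarrow> nat" where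
    "H c e = of_bool (father c) * (of_bool (e 0 0) * (if c 0 0 then need e else 4))" for c e
  have "spent c = sum5 (\<lambda>e. H c e) c" for c
    by (simp add: spent_def H_def sum5_def upkeep_def weight_def algebra_simps)
  moreover have "earned c = sum5 (\<lambda>e. H e c) c" for c
  proof -
    have "H e c = of_bool (c 0 0) * (4 * of_bool (\<not> e 0 0 \<and> father e) + of_bool (e 0 0 \<and> father e) *
      need c)" for e
      by (simp add: H_def)
    then show ?thesis
      by (simp add: earned_def sum5_def free_fathers_def code_fathers_def algebra_simps)
  qed
  ultimately show ?thesis
    using torus_sum_sum5[OF assms, of d C H] by presburger
qed

lemma torus_sum_paid:
  assumes "0 < n"
  shows "torus_sum n d C paid = torus_sum n d C (\<lambda>c. of_bool (orphan c) * recv c)"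
proof -
  have t: "torus_sum n d C (\<lambda>c. of_bool (orphan (shift a b c)) * G c) =
      torus_sum n d C (\<lambda>c. of_bool (orphan c) * G (shift (- a) (- b) c))" for a b G
    using torus_sum_shift[OF assms, of d C "\<lambda>c. of_bool (orphan (shift a b c)) * G c" "- a" "- b"]
      by simp
  have "torus_sum n d C paid = torus_sum n d C (\<lambda>c. paid_side c + paid_side (rot c) +
      paid_side (rot (rot c)) + paid_side (rot (rot (rot c))))"
    by (simp add: torus_sum_def paid_def)
  also have "\<dots> = torus_sum n d C (\<lambda>c. of_bool (orphan c) * recv c)"
    by (simp add: torus_sum_add paid_side_def recv_def sval_def distrib_left t)
  finally show ?thesis .
qed

lemma torus_sum_gifts:
  assumes "0 < n"
  shows "torus_sum n d C gifts_out = torus_sum n d C gifts_in"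
proof -
  have t: "torus_sum n d C (\<lambda>c. of_bool (gift (g (shift a b c)))) = torus_sum n d C
    (\<lambda>c. of_bool (gift (g c)))"
    for a b g
    using torus_sum_shift[OF assms, of d C "\<lambda>c. of_bool (gift (g c))" a b] by simp
  show ?thesis
    unfolding gifts_out_def[abs_def] gifts_in_def[abs_def] torus_sum_add gift_out_def
    by (simp add: t[of "\<lambda>c. c"] t[of rot] t[of "\<lambda>c. rot (rot c)"] t[of "\<lambda>c. rot (rot (rot c))"]
        t[of flip] t[of "\<lambda>c. rot (flip c)"] t[of "\<lambda>c. rot (rot (flip c))"]
        t[of "\<lambda>c. rot (rot (rot (flip c)))"])
qed

lemma torus_sum_card:
  assumes "0 < n" "C \<subseteq> {0..<n}"
  shows "torus_sum n d C (\<lambda>c. of_bool (c 0 0)) = card C"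
proof -
  have "torus_sum n d C (\<lambda>c. of_bool (c 0 0)) = (\<Sum>v\<in>{0..<n}. of_bool (v \<in> C))"
    unfolding torus_sum_def unroll_def by (rule sum.cong) auto
  also have "\<dots> = card ({0..<n} \<inter> {v. v \<in> C})"
    by (simp add: of_bool_def sum.If_cases)
  also have "{0..<n} \<inter> {v. v \<in> C} = C" using assms by auto
  finally show ?thesis .
qed

theorem ident_lower_bound:
  fixes n d :: int
  assumes n: "0 < n" and C: "C \<subseteq> {0..<n}" and id: "\<And>v. ident (unroll n d C v)"
  shows "7 * n \<le> 20 * int (card C)"
proof -
  let ?T = "torus_sum n d C"
  let ?one = "?T (\<lambda>c. of_bool (weight c = 1))"
  have w: "?T weight = 5 * card C"
  proof -
    have "weight = sum5 (\<lambda>e. of_bool (e 0 0))"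
      by (simp add: fun_eq_iff weight_def sum5_def)
    then show ?thesis
      using torus_sum_sum5[OF n, of d C "\<lambda>c e. of_bool (e 0 0)"]
        torus_sum_mult[of n d C 5 "\<lambda>c. of_bool (c 0 0)"]
        torus_sum_card[OF n C, of d] by (simp add: sum5_def torus_sum_add)
  qed
  have one: "?one + ?T (\<lambda>c. of_bool (redundant c)) = card C"
  proof -
    have "?one = ?T (\<lambda>c. sum5 (\<lambda>e. of_bool (weight c = 1 \<and> e 0 0)) c)"
      by (rule arg_cong[where f = ?T]) (auto simp: fun_eq_iff sum5_def weight_def)
    also have "\<dots> = ?T (\<lambda>c. sum5 (\<lambda>e. of_bool (weight e = 1 \<and> c 0 0)) c)"
      by (rule torus_sum_sum5[OF n])
    finally have "?one + ?T (\<lambda>c. of_bool (redundant c)) =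
        ?T (\<lambda>c. sum5 (\<lambda>e. of_bool (weight e = 1 \<and> c 0 0)) c + of_bool (redundant c))"
      by (simp add: torus_sum_add)
    also have "\<dots> = ?T (\<lambda>c. of_bool (c 0 0))"
      unfolding torus_sum_def
    proof (rule sum.cong)
      fix v
      let ?c = "unroll n d C v"
      show "sum5 (\<lambda>e. of_bool (weight e = 1 \<and> ?c 0 0)) ?c + of_bool (redundant ?c) = of_bool
        (?c 0 0)"
        using private_unique[OF id[of v]] by (cases "?c 0 0") (simp_all add: sum5_def redundant_def)
    qed simp
    finally show ?thesis using torus_sum_card[OF n C] by simp
  qed
  have excess: "?T (\<lambda>c. weight c - 2) + 2 * nat n = 5 * card C + ?one"
  proof -
    \<comment> \<open>Subtraction is truncated and weight 0 does not occur, so the correction is 1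
      exactly at weight 1.\<close>
    have "?T (\<lambda>c. weight c - 2 + 2) = ?T (\<lambda>c. weight c + of_bool (weight c = 1))"
      unfolding torus_sum_def
    proof (rule sum.cong)
      fix v
      let ?c = "unroll n d C v"
      have "0 < weight ?c" using dom[OF id[of v], of 0 0] by (auto simp: weight_def)
      then show "weight ?c - 2 + 2 = weight ?c + of_bool (weight ?c = 1)" by auto
    qed simp
    moreover have "?T (\<lambda>c. weight c - 2 + 2) = ?T (\<lambda>c. weight c - 2) + 2 * nat n"
      unfolding torus_sum_add by (simp add: torus_sum_def)
    ultimately show ?thesis using w by (simp add: torus_sum_add)
  qed
  have "?T spent + ?T paid \<le> 14 * ?T (\<lambda>c. weight c - 2)"
    using torus_sum_mono[of "\<lambda>c. spent c + paid c" n d C "\<lambda>c. 14 * (weight c - 2)"] spent_le[OF id]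
    by (simp add: torus_sum_add torus_sum_mult)
  moreover have "4 * card C + ?T gifts_out \<le>
      ?T earned + ?T (\<lambda>c. of_bool (orphan c) * recv c) + ?T gifts_in + 14 * ?T
        (\<lambda>c. of_bool (redundant c))"
  proof -
    have "?T (\<lambda>c. 4 * of_bool (c 0 0) + gifts_out c) \<le> ?T
      (\<lambda>c. earned c + of_bool (orphan c) * recv c + gifts_in c +
        14 * of_bool (redundant c))"
      by (rule torus_sum_mono) (rule budget[OF id])
    then show ?thesis
      unfolding torus_sum_add torus_sum_mult torus_sum_card[OF n C] .
  qed
  ultimately have "4 * card C \<le> 14 * ?T (\<lambda>c. weight c - 2) + 14 * ?T (\<lambda>c. of_bool (redundant c))"
    using torus_sum_spent[OF n, of d C] torus_sum_paid[OF n, of d C] torus_sum_gifts[OF n, of d C]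
      by linarith
  \<comment> \<open>Substituting \<open>excess\<close> and \<open>one\<close> cancels the number of
    private vertices: the right-hand side becomes 84 |C| - 28 n.\<close>
  then have "28 * nat n \<le> 80 * card C"
    using excess one by linarith
  then show ?thesis using n by linarith
qed

section \<open>Double counting for locating-dominating codes\<close>

text \<open>Adjacent vertices outside the code have no common codeword, so domination separates
  them. At distance 2 both centres lie in the symmetric difference of the crosses, so the
  disjunctions are those of \<open>ident\<close>.\<close>

definition locdom :: "(int \<Rightarrow> int \<Rightarrow> bool) \<Rightarrow> bool" where
  "locdom c \<longleftrightarrow> (\<forall>x y.
     (c x y \<or> c (x + 1) y \<or> c (x - 1) y \<or> c x (y + 1) \<or> c x (y - 1)) \<and>
     (c x y \<or> c (x - 1) y \<or> c x (y + 1) \<or> c x (y - 1) \<or>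
      c (x + 2) y \<or> c (x + 3) y \<or> c (x + 2) (y + 1) \<or> c (x + 2) (y - 1)) \<and>
     (c x y \<or> c x (y - 1) \<or> c (x + 1) y \<or> c (x - 1) y \<or>
      c x (y + 2) \<or> c x (y + 3) \<or> c (x + 1) (y + 2) \<or> c (x - 1) (y + 2)) \<and>
     (c x y \<or> c (x - 1) y \<or> c x (y - 1) \<or> c (x + 1) (y + 1) \<or> c (x + 2) (y + 1) \<or> c (x + 1) (y + 2))
       \<and>
     (c x y \<or> c (x - 1) y \<or> c x (y + 1) \<or> c (x + 1) (y - 1) \<or> c (x + 2) (y - 1) \<or> c (x + 1)
       (y - 2)))"

lemma
  assumes "locdom c"
  shows ld_dom: "c x y \<or> c (x + 1) y \<or> c (x - 1) y \<or> c x (y + 1) \<or> c x (y - 1)"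
    and ld20: "c x y \<or> c (x - 1) y \<or> c x (y + 1) \<or> c x (y - 1) \<or>
      c (x + 2) y \<or> c (x + 3) y \<or> c (x + 2) (y + 1) \<or> c (x + 2) (y - 1)"
    and ld02: "c x y \<or> c x (y - 1) \<or> c (x + 1) y \<or> c (x - 1) y \<or>
      c x (y + 2) \<or> c x (y + 3) \<or> c (x + 1) (y + 2) \<or> c (x - 1) (y + 2)"
    and ld11: "c x y \<or> c (x - 1) y \<or> c x (y - 1) \<or> c (x + 1) (y + 1) \<or> c (x + 2) (y + 1) \<or> c (x + 1)
      (y + 2)"
    and ld1m: "c x y \<or> c (x - 1) y \<or> c x (y + 1) \<or> c (x + 1) (y - 1) \<or> c (x + 2) (y - 1) \<or> c (x + 1)
      (y - 2)"
  using assms unfolding locdom_def by blast+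

lemma locdom_rot [simp]:
  assumes "locdom c"
  shows "locdom (rot c)"
  unfolding locdom_def rot_apply
proof (intro allI conjI, goal_cases)
  case (1 x y)
  then show ?case
    using ld_dom[OF assms, of "- y" x] by (auto simp: algebra_simps minus_diff_commute)
next
  case (2 x y)
  then show ?case
    using ld02[OF assms, of "- y" x] by (auto simp: algebra_simps minus_diff_commute)
next
  case (3 x y)
  then show ?case
    using ld20[OF assms, of "- y - 2" x] by (auto simp: algebra_simps minus_diff_commute)
next
  case (4 x y)
  then show ?case
    using ld1m[OF assms, of "- y - 1" "x + 1"] by (auto simp: algebra_simps minus_diff_commute)
next
  case (5 x y)
  then show ?case
    using ld11[OF assms, of "- y" x] by (auto simp: algebra_simps minus_diff_commute)
qed

text \<open>
  Shares are counted in units of \<open>1 / 60\<close>, which makes \<open>60 div weight c\<close> exact for weights 1 to 5.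
\<close>

definition ldshare :: "(int \<Rightarrow> int \<Rightarrow> bool) \<Rightarrow> nat" where
  "ldshare = sum5 (\<lambda>c. 60 div weight c)"

text \<open>The bound 200 stands for 10 / 3. A codeword exceeding it takes 10 units of allowance,
  that is 1 / 6, from the codeword at (2, 0).\<close>

definition takes :: "(int \<Rightarrow> int \<Rightarrow> bool) \<Rightarrow> bool" where
  "takes c \<longleftrightarrow> c 0 0 \<and> 200 < ldshare c \<and> c 2 0 \<and> (c 3 0 \<or> c 2 1 \<or> c 2 (- 1))"

definition gives :: "(int \<Rightarrow> int \<Rightarrow> bool) \<Rightarrow> bool" where
  "gives c \<longleftrightarrow> takes (shift (- 2) 0 c)"

definition ld_in :: "(int \<Rightarrow> int \<Rightarrow> bool) \<Rightarrow> nat" where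
  "ld_in c = of_bool (takes c) + of_bool (takes (rot c)) + of_bool (takes (rot (rot c))) +
     of_bool (takes (rot (rot (rot c))))"

definition ld_out :: "(int \<Rightarrow> int \<Rightarrow> bool) \<Rightarrow> nat" where
  "ld_out c = of_bool (gives c) + of_bool (gives (rot c)) + of_bool (gives (rot (rot c))) +
     of_bool (gives (rot (rot (rot c))))"

lemma ldshare_rot [simp]: "ldshare (rot c) = ldshare c"
  by (simp add: ldshare_def sum5_rot)

lemma div60_le:
  fixes k :: nat
  shows "60 div k + 30 * of_bool (2 \<le> k) + 10 * of_bool (3 \<le> k) \<le> 60"
  using div_le_mono2[of 2 k 60] div_le_mono2[of 3 k 60] by (auto simp: of_bool_def)

lemma weight_neighbour:
  assumes "c 0 0"
  shows "2 \<le> weight c \<longleftrightarrow> c 1 0 \<or> c (- 1) 0 \<or> c 0 1 \<or> c 0 (- 1)"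
    "2 \<le> weight (shift 1 0 c) \<longleftrightarrow> c 1 0 \<or> c 2 0 \<or> c 1 1 \<or> c 1 (- 1)"
    "2 \<le> weight (shift (- 1) 0 c) \<longleftrightarrow> c (- 1) 0 \<or> c (- 2) 0 \<or> c (- 1) 1 \<or> c (- 1) (- 1)"
    "2 \<le> weight (shift 0 1 c) \<longleftrightarrow> c 0 1 \<or> c 0 2 \<or> c 1 1 \<or> c (- 1) 1"
    "2 \<le> weight (shift 0 (- 1) c) \<longleftrightarrow> c 0 (- 1) \<or> c 0 (- 2) \<or> c 1 (- 1) \<or> c (- 1) (- 1)"
  using assms by (auto simp: weight_def)

lemma locdom_private_unique:
  assumes ld: "locdom c" and "c 0 0"
  shows "2 \<le> weight (shift 1 0 c) \<or> 2 \<le> weight (shift (- 1) 0 c)"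
    "2 \<le> weight (shift 1 0 c) \<or> 2 \<le> weight (shift 0 1 c)"
    "2 \<le> weight (shift 1 0 c) \<or> 2 \<le> weight (shift 0 (- 1) c)"
    "2 \<le> weight (shift (- 1) 0 c) \<or> 2 \<le> weight (shift 0 1 c)"
    "2 \<le> weight (shift (- 1) 0 c) \<or> 2 \<le> weight (shift 0 (- 1) c)"
    "2 \<le> weight (shift 0 1 c) \<or> 2 \<le> weight (shift 0 (- 1) c)"
  unfolding weight_neighbour[of c, OF assms(2)]
  using ld20[OF ld, of "- 1" 0, simplified] ld02[OF ld, of 0 "- 1", simplified]
    ld1m[OF ld, of 0 1, simplified] ld11[OF ld, of 0 "- 1", simplified]
      ld11[OF ld, of "- 1" 0, simplified]
    ld1m[OF ld, of "- 1" 0, simplified]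
  by sat+

lemma ldshare_bound:
  "ldshare c + 30 * of_bool (2 \<le> weight c) +
     30 * of_bool (2 \<le> weight (shift 1 0 c)) + 10 * of_bool (3 \<le> weight (shift 1 0 c)) +
     30 * of_bool (2 \<le> weight (shift (- 1) 0 c)) + 10 * of_bool (3 \<le> weight (shift (- 1) 0 c)) +
     30 * of_bool (2 \<le> weight (shift 0 1 c)) + 10 * of_bool (3 \<le> weight (shift 0 1 c)) +
     30 * of_bool (2 \<le> weight (shift 0 (- 1) c)) + 10 * of_bool (3 \<le> weight (shift 0 (- 1) c)) \<le>
       300"
  using div60_le[of "weight c"] div60_le[of "weight (shift 1 0 c)"]
    div60_le[of "weight (shift (- 1) 0 c)"]
    div60_le[of "weight (shift 0 1 c)"] div60_le[of "weight (shift 0 (- 1) c)"]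
  unfolding ldshare_def sum5_def by linarith

text \<open>At most one neighbour is private, so at least three of the five summands drop to 30: 300
  - 90 = 210. A codeword in the neighbourhood makes the own cross and at least three others
  non-private: 300 - 120 = 180.\<close>

lemma ldshare_le:
  assumes ld: "locdom c" and c: "c 0 0"
  shows "ldshare c \<le> 210"
    and "c 1 0 \<or> c (- 1) 0 \<or> c 0 1 \<or> c 0 (- 1) \<Longrightarrow> ldshare c \<le> 180"
proof -
  have u: "3 \<le> of_bool (2 \<le> weight (shift 1 0 c)) + of_bool (2 \<le> weight (shift (- 1) 0 c)) +
      of_bool (2 \<le> weight (shift 0 1 c)) + (of_bool (2 \<le> weight (shift 0 (- 1) c)) :: nat)"
    using locdom_private_unique[OF ld c] by (auto simp: of_bool_def)
  show "ldshare c \<le> 210"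
    using ldshare_bound[of c] u by linarith
  assume "c 1 0 \<or> c (- 1) 0 \<or> c 0 1 \<or> c 0 (- 1)"
  then have "2 \<le> weight c" using weight_neighbour[of c, OF c] by blast
  then show "ldshare c \<le> 180"
    using ldshare_bound[of c] u by simp
qed

text \<open>One more codeword in any of the three other neighbouring crosses would lower 210 to 200,
  so these have weight exactly 2. This forces (0, 2) and (-2, 0), and domination and separation
  around (-1, 1) give one of them a neighbour in the code.\<close>

lemma bad_right:
  assumes ld: "locdom c" and c: "c 0 0" and b: "200 < ldshare c" and p: "\<not> 2 \<le> weight (shift 1 0 c)"
  shows "takes (rot c) \<or> takes (rot (rot c))"
proof -
  note u = locdom_private_unique[OF ld c]
  have "\<not> 3 \<le> weight (shift (- 1) 0 c)" "\<not> 3 \<le> weight (shift 0 1 c)"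
    "\<not> 3 \<le> weight (shift 0 (- 1) c)"
    using b ldshare_bound[of c] u p by (auto simp: of_bool_def split: if_splits)
  then have f: "\<not> father (shift (- 1) 0 c)" "\<not> father (shift 0 1 c)" "\<not> father (shift 0 (- 1) c)"
    by (simp_all add: father_def)
  have i: "\<not> (c 1 0 \<or> c (- 1) 0 \<or> c 0 1 \<or> c 0 (- 1))"
    using b ldshare_le(2)[OF ld c] by auto
  have "c 0 2 \<and> c (- 2) 0 \<and> (c (- 2) 1 \<or> c (- 1) 2)"
    using c i f[unfolded not_father_cnf, simplified] p[unfolded weight_neighbour[of c, OF c]]
      u[unfolded weight_neighbour[of c, OF c]]
      ld_dom[OF ld, of "- 1" 1, simplified] ld1m[OF ld, of "- 1" 0, simplified]
        ld11[OF ld, of "- 1" 0, simplified]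
    by sat
  then show ?thesis using c b by (auto simp: takes_def)
qed

lemma bad_takes:
  assumes ld: "locdom c" and c: "c 0 0" and b: "200 < ldshare c"
  shows "1 \<le> ld_in c"
proof -
  have "\<not> 2 \<le> weight (shift 1 0 c) \<or> \<not> 2 \<le> weight (shift (- 1) 0 c) \<or>
      \<not> 2 \<le> weight (shift 0 1 c) \<or> \<not> 2 \<le> weight (shift 0 (- 1) c)"
    using b ldshare_bound[of c] by (auto simp: of_bool_def split: if_splits)
  then have "takes c \<or> takes (rot c) \<or> takes (rot (rot c)) \<or> takes (rot (rot (rot c)))"
    using bad_right[of c] bad_right[of "rot c"] bad_right[of "rot (rot c)"]
      bad_right[of "rot (rot (rot c))"]
      ld c b by auto
  then show ?thesis by (auto simp: ld_in_def)
qed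

lemma gives_D:
  assumes "locdom c" "locdom (shift (- 2) 0 c)" "gives c"
  shows "c 0 0" "c (- 2) 0" "\<not> c (- 1) 0" "c 1 0 \<or> c 0 1 \<or> c 0 (- 1)"
  using assms ldshare_le(2)[of "shift (- 2) 0 c"] by (auto simp: gives_def takes_def)

text \<open>A codeword that gives has a neighbour in the code, hence share at most 180, enough for
  two takers; with more takers its share is at most 150.\<close>

lemma ld_budget:
  assumes ld: "\<And>a b. locdom (shift a b c)"
  shows "of_bool (c 0 0) * ldshare c + 10 * ld_out c \<le> 200 * of_bool (c 0 0) + 10 * ld_in c"
proof (cases "c 0 0")
  case False
  have ld0: "locdom c" using ld[of 0 0] by simp
  have "ld_out c = 0"
    using False gives_D(1)[of c] gives_D(1)[of "rot c"] gives_D(1)[of "rot (rot c)"]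
      gives_D(1)[of "rot (rot (rot c))"]
      ld0 ld by (auto simp: ld_out_def)
  then show ?thesis using False by simp
next
  case c: True
  have ld0: "locdom c" using ld[of 0 0] by simp
  note g = gives_D[of c] gives_D[of "rot c"] gives_D[of "rot (rot c)"]
    gives_D[of "rot (rot (rot c))"]
  show ?thesis
  proof (cases "c 1 0 \<or> c (- 1) 0 \<or> c 0 1 \<or> c 0 (- 1)")
    case False
    then have "ld_out c = 0" using g ld0 ld by (auto simp: ld_out_def)
    then show ?thesis using c ldshare_le(1)[OF ld0 c] bad_takes[OF ld0 c] by
      (cases "200 < ldshare c") auto
  next
    case True
    have s: "ldshare c \<le> 180" using ldshare_le(2)[OF ld0 c True] .
    show ?thesis
    proof (cases "ld_out c \<le> 2")
      case True
      then show ?thesis using c s by simp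
    next
      case many: False
      have k: "gives c \<Longrightarrow> c (- 2) 0 \<and> \<not> c (- 1) 0" "gives (rot c) \<Longrightarrow> c 0 (- 2) \<and> \<not> c 0 (- 1)"
        "gives (rot (rot c)) \<Longrightarrow> c 2 0 \<and> \<not> c 1 0" "gives (rot (rot (rot c))) \<Longrightarrow> c 0 2 \<and> \<not> c 0 1"
        using g ld0 ld by auto
      have "gives c \<and> gives (rot c) \<and> gives (rot (rot c)) \<or> gives c \<and> gives (rot c) \<and> gives
        (rot (rot (rot c))) \<or>
        gives c \<and> gives (rot (rot c)) \<and> gives (rot (rot (rot c))) \<or>
        gives (rot c) \<and> gives (rot (rot c)) \<and> gives (rot (rot (rot c)))"
        using many by (auto simp: ld_out_def of_bool_def split: if_splits)
      \<comment> \<open>Three sides have a codeword at distance 2 and none at distance 1, so the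
        adjacent codeword is on the fourth side and no cross is private.\<close>
      then have "2 \<le> weight c \<and> 2 \<le> weight (shift 1 0 c) \<and> 2 \<le> weight (shift (- 1) 0 c) \<and>
         2 \<le> weight (shift 0 1 c) \<and> 2 \<le> weight (shift 0 (- 1) c)"
        unfolding weight_neighbour[of c, OF c] using k True by blast
      then have "ldshare c \<le> 150"
        using ldshare_bound[of c] by simp
      moreover have "ld_out c \<le> 4" by (simp add: ld_out_def of_bool_def)
      ultimately show ?thesis using c by simp
    qed
  qed
qed

lemma torus_sum_ld:
  assumes "0 < n"
  shows "torus_sum n d C ld_out = torus_sum n d C ld_in"
proof -
  have t: "torus_sum n d C (\<lambda>c. of_bool (takes (g (shift a b c)))) = torus_sum n d C
    (\<lambda>c. of_bool (takes (g c)))"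
    for a b g
    using torus_sum_shift[OF assms, of d C "\<lambda>c. of_bool (takes (g c))" a b] by simp
  show ?thesis
    unfolding ld_out_def[abs_def] ld_in_def[abs_def] torus_sum_add gives_def
    by (simp add: t[of "\<lambda>c. c"] t[of rot] t[of "\<lambda>c. rot (rot c)"] t[of "\<lambda>c. rot (rot (rot c))"])
qed

theorem locdom_lower_bound:
  fixes n d :: int
  assumes n: "0 < n" and C: "C \<subseteq> {0..<n}" and ld: "\<And>v. locdom (unroll n d C v)"
  shows "3 * n \<le> 10 * int (card C)"
proof -
  let ?T = "torus_sum n d C"
  have "?T (\<lambda>c. of_bool (c 0 0) * ldshare c) = ?T (\<lambda>c. sum5
    (\<lambda>e. of_bool (c 0 0) * (60 div weight e)) c)"
    by (simp add: ldshare_def sum5_def distrib_left)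
  also have "\<dots> = ?T (\<lambda>c. sum5 (\<lambda>e. of_bool (e 0 0) * (60 div weight c)) c)"
    by (rule torus_sum_sum5[OF n])
  also have "\<dots> = 60 * nat n"
  proof -
    \<comment> \<open>Each vertex splits 60 units evenly among the codewords in its cross.\<close>
    have "sum5 (\<lambda>e. of_bool (e 0 0) * (60 div weight c)) c = 60" if "c = unroll n d C v" for v c
    proof -
      have "0 < weight c" using ld_dom[OF ld[of v], of 0 0] that by (auto simp: weight_def)
      moreover have "weight c \<le> 5" by (simp add: weight_def of_bool_def)
      ultimately have "weight c \<in> {1, 2, 3, 4, 5}" by auto
      moreover have "sum5 (\<lambda>e. of_bool (e 0 0) * (60 div weight c)) c = weight c *
        (60 div weight c)"
        by (simp add: sum5_def weight_def distrib_right)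
      ultimately show ?thesis by auto
    qed
    then show ?thesis by (simp add: torus_sum_def)
  qed
  finally have "60 * nat n + 10 * ?T ld_out = ?T (\<lambda>c. of_bool (c 0 0) * ldshare c + 10 * ld_out c)"
    by (simp add: torus_sum_add torus_sum_mult)
  also have "\<dots> \<le> ?T (\<lambda>c. 200 * of_bool (c 0 0) + 10 * ld_in c)"
  proof (rule torus_sum_mono)
    fix v
    show "of_bool (unroll n d C v 0 0) * ldshare (unroll n d C v) + 10 * ld_out (unroll n d C v) \<le>
       200 * of_bool (unroll n d C v 0 0) + 10 * ld_in (unroll n d C v)"
      by (rule ld_budget) (simp add: shift_unroll ld)
  qed
  also have "\<dots> = 200 * card C + 10 * ?T ld_out"
    using torus_sum_card[OF n C] torus_sum_ld[OF n] by (simp add: torus_sum_add torus_sum_mult)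
  finally show ?thesis using n by linarith
qed

section \<open>Circulant graphs\<close>

definition nbhd :: "int \<Rightarrow> int \<Rightarrow> int \<Rightarrow> int set" where
  "nbhd n d z = {z mod n, (z + 1) mod n, (z - 1) mod n, (z + d) mod n, (z - d) mod n}"

lemma pverts_circulant [simp]: "pverts (circulant_graph n ds) = {0..<int n}"
  by (simp add: circulant_graph_def)

lemma I_set_circulant:
  assumes "0 < n"
  shows "I_set (circulant_graph n [1, d]) C (z mod int n) = nbhd (int n) (int d) z \<inter> C"
  using assms by (auto simp: I_set_def closed_nbhd_def circulant_graph_def nbhd_def mod_simps)

lemma mod_add_neq:
  fixes n t z :: int
  assumes "t \<noteq> 0" "\<bar>t\<bar> < n"
  shows "z mod n \<noteq> (z + t) mod n"
proof
  assume "z mod n = (z + t) mod n"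
  then have "n dvd \<bar>t\<bar>" by (simp add: mod_eq_dvd_iff)
  then show False using zdvd_imp_le[of n "\<bar>t\<bar>"] assms by simp
qed

text \<open>The separating codeword is located by an integer offset outside the other cross of
  offsets, so coincidences modulo \<open>n\<close> cause no harm.\<close>

lemma nbhd_sep:
  assumes "nbhd n d z \<inter> C \<noteq> nbhd n d (z + t) \<inter> C"
  shows "\<exists>s\<in>{0, 1, - 1, d, - d}. (z + s) mod n \<in> C \<and> s \<notin> {t, t + 1, t - 1, t + d, t - d} \<or>
    (z + t + s) mod n \<in> C \<and> t + s \<notin> {0, 1, - 1, d, - d}"
proof (rule ccontr)
  assume a: "\<not> ?thesis"
  have N: "nbhd n d w = (\<lambda>s. (w + s) mod n) ` {0, 1, - 1, d, - d}" for w
    by (simp add: nbhd_def)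
  have "x \<in> nbhd n d z \<longleftrightarrow> x \<in> nbhd n d (z + t)" if "x \<in> C" for x
  proof
    assume "x \<in> nbhd n d z"
    then obtain s where s: "s \<in> {0, 1, - 1, d, - d}" "x = (z + s) mod n" unfolding N by blast
    then have "s \<in> {t, t + 1, t - 1, t + d, t - d}" using a that by blast
    then have "s - t \<in> {0, 1, - 1, d, - d}" by auto
    then show "x \<in> nbhd n d (z + t)" unfolding N using s(2) by (intro image_eqI[of _ _ "s - t"])
      auto
  next
    assume "x \<in> nbhd n d (z + t)"
    then obtain s where s: "s \<in> {0, 1, - 1, d, - d}" "x = (z + t + s) mod n" unfolding N by blast
    then have "t + s \<in> {0, 1, - 1, d, - d}" using a that by blast
    then show "x \<in> nbhd n d z" unfolding N using s(2) by (intro image_eqI[of _ _ "t + s"])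
      (auto simp: add.assoc)
  qed
  then show False using assms by blast
qed

lemma identifying_unroll:
  assumes d: "2 \<le> d" "2 * d < n" and C: "identifying_code (circulant_graph n [1, d]) C"
  shows "ident (unroll (int n) (int d) C v)"
proof -
  let ?n = "int n" and ?d = "int d"
  have n: "0 < n" using d by simp
  have ne: "nbhd ?n ?d z \<inter> C \<noteq> {}" for z
    using C n I_set_circulant[OF n, of d C z] by (auto simp: identifying_code_def
      dominating_code_def)
  have sep: "nbhd ?n ?d z \<inter> C \<noteq> nbhd ?n ?d (z + t) \<inter> C" if "t \<in> {1, ?d, 2, 2 * ?d, 1 + ?d, 1 - ?d}"
    for z t
  proof -
    \<comment> \<open>\<open>2 * d < n\<close> bounds every \<open>t\<close> below \<open>n\<close>
      in absolute value, and \<open>2 \<le> d\<close> keeps \<open>1 - d\<close> nonzero.\<close>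
    have "z mod ?n \<noteq> (z + t) mod ?n"
      by (rule mod_add_neq) (use that d in auto)
    then have "I_set (circulant_graph n [1, d]) C (z mod ?n) \<noteq> I_set (circulant_graph n [1, d]) C
      ((z + t) mod ?n)"
      using C n unfolding identifying_code_def by simp
    then show ?thesis
      by (simp only: I_set_circulant[OF n] not_False_eq_True)
  qed
  have dom: "z mod ?n \<in> C \<or> (z + 1) mod ?n \<in> C \<or> (z - 1) mod ?n \<in> C \<or> (z + ?d) mod ?n \<in> C \<or> (z - ?d)
    mod ?n \<in> C"
    for z
    using ne[of z] by (auto simp: nbhd_def)
  note sp = nbhd_sep[OF sep]
  show ?thesis
    unfolding ident_def unroll_def
  proof (intro allI conjI, goal_cases)
    case (1 x y)
    then show ?case using dom[of "v + x + ?d * y"] by (auto simp: algebra_simps)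
  next
    case (2 x y)
    then show ?case using sp[of 1 "v + x + ?d * y"] by (auto simp: algebra_simps)
  next
    case (3 x y)
    then show ?case using sp[of ?d "v + x + ?d * y"] by (auto simp: algebra_simps)
  next
    case (4 x y)
    then show ?case using sp[of 2 "v + x + ?d * y"] by (auto simp: algebra_simps)
  next
    case (5 x y)
    then show ?case using sp[of "2 * ?d" "v + x + ?d * y"] by (auto simp: algebra_simps)
  next
    case (6 x y)
    then show ?case using sp[of "1 + ?d" "v + x + ?d * y"] by (auto simp: algebra_simps)
  next
    case (7 x y)
    then show ?case using sp[of "1 - ?d" "v + x + ?d * y"] by (auto simp: algebra_simps)
  qed
qed

lemma locating_unroll:
  assumes d: "2 \<le> d" "2 * d < n" and C: "locating_dominating_code (circulant_graph n [1, d]) C"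
  shows "locdom (unroll (int n) (int d) C v)"
proof -
  let ?n = "int n" and ?d = "int d"
  have n: "0 < n" using d by simp
  have ne: "nbhd ?n ?d z \<inter> C \<noteq> {}" for z
    using C n I_set_circulant[OF n, of d C z] by (auto simp: locating_dominating_code_def
      dominating_code_def)
  have sep: "nbhd ?n ?d z \<inter> C \<noteq> nbhd ?n ?d (z + t) \<inter> C"
    if "t \<in> {2, 2 * ?d, 1 + ?d, 1 - ?d}" "z mod ?n \<notin> C" "(z + t) mod ?n \<notin> C" for z t
  proof -
    have "z mod ?n \<noteq> (z + t) mod ?n"
      by (rule mod_add_neq) (use that d in auto)
    then have "I_set (circulant_graph n [1, d]) C (z mod ?n) \<noteq> I_set (circulant_graph n [1, d]) C
      ((z + t) mod ?n)"
      using C n that unfolding locating_dominating_code_def by simp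
    then show ?thesis
      by (simp only: I_set_circulant[OF n] not_False_eq_True)
  qed
  have dom: "z mod ?n \<in> C \<or> (z + 1) mod ?n \<in> C \<or> (z - 1) mod ?n \<in> C \<or> (z + ?d) mod ?n \<in> C \<or> (z - ?d)
    mod ?n \<in> C"
    for z
    using ne[of z] by (auto simp: nbhd_def)
  note sp = nbhd_sep[OF sep]
  show ?thesis
    unfolding locdom_def unroll_def
  proof (intro allI conjI, goal_cases)
    case (1 x y)
    then show ?case using dom[of "v + x + ?d * y"] by (auto simp: algebra_simps)
  next
    case (2 x y)
    then show ?case using sp[of 2 "v + x + ?d * y"] by (auto simp: algebra_simps)
  next
    case (3 x y)
    then show ?case using sp[of "2 * ?d" "v + x + ?d * y"] by (auto simp: algebra_simps)
  next
    case (4 x y)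
    then show ?case using sp[of "1 + ?d" "v + x + ?d * y"] by (auto simp: algebra_simps)
  next
    case (5 x y)
    then show ?case using sp[of "1 - ?d" "v + x + ?d * y"] by (auto simp: algebra_simps)
  qed
qed

section \<open>Codes that are unions of residue classes\<close>

definition residue_nbhd :: "int \<Rightarrow> int \<Rightarrow> int set \<Rightarrow> int \<Rightarrow> int set" where
  "residue_nbhd m d S a = set (filter (\<lambda>r. r \<in> S) (map (\<lambda>t. (a + t) mod m) [0, 1, - 1, d, - d]))"

lemma residue_nbhd_mod: "residue_nbhd m d S (a mod m) = residue_nbhd m d S a"
  by (simp add: residue_nbhd_def mod_simps)

definition residue_code :: "nat \<Rightarrow> int \<Rightarrow> int set \<Rightarrow> int set" where
  "residue_code n m S = {v \<in> {0..<int n}. v mod m \<in> S}"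

lemma card_residue_code:
  assumes "0 < m" "m dvd int n" "S \<subseteq> {0..<m}"
  shows "int (card (residue_code n m S)) * m = int n * int (card S)"
proof -
  obtain k where k: "int n = m * k" using assms(2) by blast
  have "0 \<le> k" using k assms(1) by (metis of_nat_0_le_iff zero_le_mult_iff not_less)
  have "bij_betw (\<lambda>(r, q). r + m * q) (S \<times> {0..<k}) (residue_code n m S)"
  proof (rule bij_betw_byWitness[where f' = "\<lambda>v. (v mod m, v div m)"])
    have r: "0 \<le> r \<and> r < m" if "r \<in> S" for r using assms(3) that by auto
    have "r + m * q < m * k" if "r \<in> S" "q < k" for r q
    proof -
      have "r + m * q < m * (q + 1)" using r[OF that(1)] by (simp add: algebra_simps)
      also have "\<dots> \<le> m * k" using that(2) assms(1) by (intro mult_left_mono) auto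
      finally show ?thesis .
    qed
    then show "(\<lambda>(r, q). r + m * q) ` (S \<times> {0..<k}) \<subseteq> residue_code n m S"
      using r assms(1) by (auto simp: residue_code_def k)
    show "\<forall>a\<in>S \<times> {0..<k}. ((case a of (r, q) \<Rightarrow> r + m * q) mod m, (case a of (r, q) \<Rightarrow> r + m * q) div
      m) = a"
      using r assms(1) by auto
    show "\<forall>a'\<in>residue_code n m S. (case (a' mod m, a' div m) of (r, q) \<Rightarrow> r + m * q) = a'"
      by simp
    have "v div m < k" if "v < m * k" for v
    proof (rule ccontr)
      assume "\<not> ?thesis"
      then have "m * k \<le> m * (v div m)" using assms(1) by simp
      also have "\<dots> \<le> v" using mult_div_mod_eq[of m v] pos_mod_sign[OF assms(1), of v] by linarith
      finally show False using that by simp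
    qed
    then show "(\<lambda>v. (v mod m, v div m)) ` residue_code n m S \<subseteq> S \<times> {0..<k}"
      using assms(1) by (auto simp: residue_code_def k pos_imp_zdiv_nonneg_iff)
  qed
  then have "card (residue_code n m S) = card S * nat k"
    by (simp add: bij_betw_same_card[symmetric] card_cartesian_product)
  then show ?thesis using k \<open>0 \<le> k\<close> by simp
qed

context
  fixes n d :: nat and m d\<^sub>0 :: int and S :: "int set"
  assumes n: "0 < n" and m: "0 < m" "m dvd int n" and d: "int d mod m = d\<^sub>0 mod m"
    and ne: "\<And>a. a \<in> {0..<m} \<Longrightarrow> residue_nbhd m d\<^sub>0 S a \<noteq> {}"
    and distinct: "distinct (map (\<lambda>t. t mod m) [0, 1, - 1, d\<^sub>0, - d\<^sub>0])"
begin

lemma residues_I_set: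
  "(\<lambda>x. x mod m) ` I_set (circulant_graph n [1, d]) (residue_code n m S) (z mod int n) =
    residue_nbhd m d\<^sub>0 S z"
proof -
  have e: "(z + int d) mod m = (z + d\<^sub>0) mod m" "(z - int d) mod m = (z - d\<^sub>0) mod m"
    using d by (metis mod_add_right_eq, metis mod_diff_right_eq)
  have c: "w mod int n \<in> residue_code n m S \<longleftrightarrow> w mod m \<in> S" for w
    using n m by (simp add: residue_code_def mod_mod_cancel)
  show ?thesis
    unfolding I_set_circulant[OF n] residue_nbhd_def nbhd_def
    by (simp add: Int_insert_left c e mod_mod_cancel[OF m(2)])
qed

lemma residue_dominating: "dominating_code (circulant_graph n [1, d]) (residue_code n m S)"
proof -
  have I: "I_set (circulant_graph n [1, d]) (residue_code n m S) u \<noteq> {}" if "u \<in> {0..<int n}" for u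
    using residues_I_set[of u] ne[of "u mod m"] m(1) that by (auto simp: residue_nbhd_mod)
  moreover have "residue_code n m S \<noteq> {}"
    using I[of 0] n by (fastforce simp: I_set_def)
  ultimately show ?thesis
    by (auto simp: dominating_code_def code_def residue_code_def)
qed

text \<open>Equal codeword sets make the residues of \<open>u\<close> and \<open>v\<close> agree. A
  common codeword is \<open>u + s\<close> and \<open>v + t\<close>; then \<open>s\<close> and
  \<open>t\<close> agree modulo \<open>m\<close>, and since the five offsets are distinct modulo
  \<open>m\<close>, \<open>s = t\<close> and \<open>u = v\<close>.\<close>

lemma residue_separated:
  assumes A: "inj_on (residue_nbhd m d\<^sub>0 S) A" and u: "u \<in> {0..<int n}" "u mod m \<in> A"
    and v: "v \<in> {0..<int n}" "v mod m \<in> A"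
    and eq: "I_set (circulant_graph n [1, d]) (residue_code n m S) u = I_set
      (circulant_graph n [1, d]) (residue_code n m S) v"
  shows "u = v"
proof -
  have "residue_nbhd m d\<^sub>0 S (u mod m) = residue_nbhd m d\<^sub>0 S (v mod m)"
    using residues_I_set[of u] residues_I_set[of v] u(1) v(1) eq by (simp add: residue_nbhd_mod)
  then have uv: "u mod m = v mod m" using inj_onD[OF A] u v by blast
  have "I_set (circulant_graph n [1, d]) (residue_code n m S) (u mod int n) \<noteq> {}"
    using residue_dominating u by (simp add: dominating_code_def)
  moreover have "I_set (circulant_graph n [1, d]) (residue_code n m S) (u mod int n) =
      I_set (circulant_graph n [1, d]) (residue_code n m S) (v mod int n)"
    using eq u v by simp
  ultimately obtain x where x: "x \<in> nbhd (int n) (int d) u" "x \<in> nbhd (int n) (int d) v"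
    unfolding I_set_circulant[OF n] by blast
  have N: "nbhd (int n) (int d) w = (\<lambda>s. (w + s) mod int n) ` {0, 1, - 1, int d, - int d}" for w
    by (simp add: nbhd_def)
  obtain s where s: "s \<in> {0, 1, - 1, int d, - int d}" "x = (u + s) mod int n"
    using x(1) unfolding N by (elim imageE)
  obtain t where t: "t \<in> {0, 1, - 1, int d, - int d}" "x = (v + t) mod int n"
    using x(2) unfolding N by (elim imageE)
  note st = s(1) t(1) trans[OF s(2)[symmetric] t(2)]
  have "(u + s) mod m = (v + t) mod m"
    using st(3) mod_mod_cancel[OF m(2)] by metis
  then have "m dvd (u - v) + (s - t)" by (simp add: mod_eq_dvd_iff algebra_simps)
  moreover have "m dvd u - v" using uv by (simp add: mod_eq_dvd_iff)
  ultimately have "s mod m = t mod m" by (metis dvd_add_right_iff mod_eq_dvd_iff)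
  moreover have "(- int d) mod m = (- d\<^sub>0) mod m" using d by (metis mod_minus_eq)
  ultimately have "s = t"
    using st(1,2) distinct d
    by (simp only: list.map distinct.simps set_simps insert_iff empty_iff) (elim disjE; simp)
  then have "int n dvd u - v" using st(3) by (simp add: mod_eq_dvd_iff)
  then show "u = v" using u v by (metis atLeastLessThan_iff mod_eq_dvd_iff mod_pos_pos_trivial)
qed

lemma residue_identifying:
  assumes "inj_on (residue_nbhd m d\<^sub>0 S) {0..<m}"
  shows "identifying_code (circulant_graph n [1, d]) (residue_code n m S)"
  unfolding identifying_code_def
  using residue_dominating residue_separated[OF assms] m(1) by auto

lemma residue_locating:
  assumes "inj_on (residue_nbhd m d\<^sub>0 S) ({0..<m} - S)"
  shows "locating_dominating_code (circulant_graph n [1, d]) (residue_code n m S)"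
  unfolding locating_dominating_code_def
proof (intro conjI ballI impI notI)
  show "dominating_code (circulant_graph n [1, d]) (residue_code n m S)"
    by (rule residue_dominating)
  fix u v
  assume uv: "u \<in> pverts (circulant_graph n [1, d]) - residue_code n m S"
    "v \<in> pverts (circulant_graph n [1, d]) - residue_code n m S" "u \<noteq> v"
    and eq: "I_set (circulant_graph n [1, d]) (residue_code n m S) u =
      I_set (circulant_graph n [1, d]) (residue_code n m S) v"
  have "u \<in> {0..<int n}" "v \<in> {0..<int n}" "u mod m \<in> {0..<m} - S" "v mod m \<in> {0..<m} - S"
    using uv(1,2) m(1) by (simp_all add: residue_code_def)
  then show False
    using residue_separated[OF assms _ _ _ _ eq] uv(3) by blast
qed

end

section \<open>Minimum cardinalities and explicit codes\<close>

lemma finite_codes: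
  assumes "\<And>C. P C \<Longrightarrow> C \<subseteq> {0..<int n}"
  shows "finite {card C | C. P C}"
proof -
  have "{C. P C} \<subseteq> Pow {0..<int n}" using assms by auto
  then have "finite {C. P C}" by (rule finite_subset) simp
  then show ?thesis by simp
qed

lemma gamma_ID_circulant:
  assumes d: "2 \<le> d" "2 * d < n" and C: "identifying_code (circulant_graph n [1, d]) C"
    and card: "20 * card C = 7 * n"
  shows "real (gamma_ID (circulant_graph n [1, d])) = 7 * real n / 20"
proof -
  have "gamma_ID (circulant_graph n [1, d]) = card C"
    unfolding gamma_ID_def
  proof (rule Min_eqI)
    show "finite {card C | C. identifying_code (circulant_graph n [1, d]) C}"
      by (rule finite_codes[where n = n]) (simp add: identifying_code_def dominating_code_def
        code_def)
    fix k
    assume "k \<in> {card C | C. identifying_code (circulant_graph n [1, d]) C}"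
    then obtain D where D: "identifying_code (circulant_graph n [1, d]) D" "k = card D" by blast
    have "7 * int n \<le> 20 * int (card D)"
      by (rule ident_lower_bound[where d = "int d"])
        (use d D identifying_unroll[OF d D(1)] in \<open>auto simp: identifying_code_def
          dominating_code_def code_def\<close>)
    then show "card C \<le> k" using card D(2) by linarith
  qed (use C in blast)
  moreover have "20 * real (card C) = 7 * real n"
    using card by (metis of_nat_mult of_nat_numeral)
  ultimately show ?thesis by simp
qed

lemma gamma_LD_circulant:
  assumes d: "2 \<le> d" "2 * d < n" and C: "locating_dominating_code (circulant_graph n [1, d]) C"
    and card: "10 * card C = 3 * n"
  shows "real (gamma_LD (circulant_graph n [1, d])) = 3 * real n / 10"
proof -
  have "gamma_LD (circulant_graph n [1, d]) = card C"
    unfolding gamma_LD_def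
  proof (rule Min_eqI)
    show "finite {card C | C. locating_dominating_code (circulant_graph n [1, d]) C}"
      by (rule finite_codes[where n = n]) (simp add: locating_dominating_code_def
        dominating_code_def code_def)
    fix k
    assume "k \<in> {card C | C. locating_dominating_code (circulant_graph n [1, d]) C}"
    then obtain D where D: "locating_dominating_code (circulant_graph n [1, d]) D" "k = card D" by
      blast
    have "3 * int n \<le> 10 * int (card D)"
      by (rule locdom_lower_bound[where d = "int d"])
        (use d D locating_unroll[OF d D(1)] in \<open>auto simp: locating_dominating_code_def
          dominating_code_def code_def\<close>)
    then show "card C \<le> k" using card D(2) by linarith
  qed (use C in blast)
  moreover have "10 * real (card C) = 3 * real n"
    using card by (metis of_nat_mult of_nat_numeral)
  ultimately show ?thesis by simp
qed

lemma inj_on_distinct_map: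
  assumes "distinct (map f xs)"
  shows "inj_on f (set xs)"
  using assms by (simp add: distinct_map)

lemma atLeastLessThan_upto: "{0..<20} = set [0..19]" "{0..<40} = set [0..(39 :: int)]"
  by auto

text \<open>Finite checks by evaluation. The densities are 7 of 20 residues here, 14 of 40 in the
  second set, and 6 of 20 in the locating-dominating one.\<close>

lemma residues_20_6:
  "distinct (map (residue_nbhd 20 6 {0, 1, 3, 4, 10, 12, 14}) [0..19])"
  "list_all (\<lambda>a. residue_nbhd 20 6 {0, 1, 3, 4, 10, 12, 14} a \<noteq> {}) [0..19]"
  unfolding residue_nbhd_def by code_simp+

lemma residues_40_4:
  "distinct (map (residue_nbhd 40 4 {1, 2, 3, 9, 11, 13, 17, 19, 23, 25, 27, 33, 34, 35}) [0..39])"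
  "list_all (\<lambda>a. residue_nbhd 40 4 {1, 2, 3, 9, 11, 13, 17, 19, 23, 25, 27, 33, 34, 35} a \<noteq> {})
    [0..39]"
  unfolding residue_nbhd_def by code_simp+

lemma residues_20_5:
  "distinct (map (residue_nbhd 20 5 {0, 3, 6, 9, 13, 16})
    (filter (\<lambda>a. a \<notin> {0, 3, 6, 9, 13, 16}) [0..19]))"
  "list_all (\<lambda>a. residue_nbhd 20 5 {0, 3, 6, 9, 13, 16} a \<noteq> {}) [0..19]"
  unfolding residue_nbhd_def by code_simp+

text \<open>\<open>2 * d = n\<close> would make \<open>2 * r\<close> divisible by \<open>m\<close>;
  so the inequality is strict and the vertices at distance 2 are distinct.\<close>

lemma congruence_parameters:
  fixes m n d r :: nat
  assumes "[n = 0] (mod m)" "[d = r] (mod m)" "r < m" "2 \<le> r" "\<not> m dvd 2 * r" "2 * d \<le> n"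
  shows "int m dvd int n" "int d mod int m = int r" "2 \<le> d" "2 * d < n"
proof -
  show n: "int m dvd int n" using assms(1) by (simp add: cong_0_iff)
  have d: "d mod m = r" using assms(2,3) by (simp add: cong_def)
  then show "int d mod int m = int r" by (simp flip: of_nat_mod)
  show "2 \<le> d" using d assms(4) mod_less_eq_dividend[of d m] by linarith
  have "2 * d \<noteq> n"
  proof
    assume "2 * d = n"
    then have "[2 * r = 0] (mod m)"
      using assms(1) cong_scalar_left[OF assms(2), of 2] by (metis cong_sym cong_trans)
    then show False using assms(5) by (simp add: cong_0_iff)
  qed
  then show "2 * d < n" using assms(6) by simp
qed

theorem theorem4:
  fixes n d :: nat
  assumes "0 < n" and "0 < d" and "n \<ge> 2 * d"
  shows "([n = 0] (mod 40) \<and> [d = 4] (mod 40) \<longrightarrow>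
            real (gamma_ID (circulant_graph n [1, d])) = 7 * real n / 20) \<and>
         ([n = 0] (mod 20) \<and> [d = 6] (mod 20) \<longrightarrow>
            real (gamma_ID (circulant_graph n [1, d])) = 7 * real n / 20) \<and>
         ([n = 0] (mod 20) \<and> [d = 5] (mod 20) \<longrightarrow>
            real (gamma_LD (circulant_graph n [1, d])) = 3 * real n / 10)"
proof (intro conjI impI; elim conjE)
  assume nd: "[n = 0] (mod 40)" "[d = 4] (mod 40)"
  let ?S = "{1, 2, 3, 9, 11, 13, 17, 19, 23, 25, 27, 33, 34, 35} :: int set"
  note p = congruence_parameters[OF nd _ _ _ assms(3), simplified]
  have m: "(0 :: int) < 40" "40 dvd int n" and d0: "int d mod 40 = 4 mod 40"
    using p by simp_all
  have ne: "residue_nbhd 40 4 ?S a \<noteq> {}" if "a \<in> {0..<40}" for a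
    using residues_40_4(2) that unfolding atLeastLessThan_upto list_all_iff by blast
  have C: "identifying_code (circulant_graph n [1, d]) (residue_code n 40 ?S)"
    by (rule residue_identifying[OF assms(1) m d0 ne])
      (use inj_on_distinct_map[OF residues_40_4(1)] in \<open>simp_all add: atLeastLessThan_upto\<close>)
  show "real (gamma_ID (circulant_graph n [1, d])) = 7 * real n / 20"
  proof (rule gamma_ID_circulant[OF _ _ C])
    show "2 \<le> d" "2 * d < n" using p by simp_all
    show "20 * card (residue_code n 40 ?S) = 7 * n"
      using card_residue_code[OF m, of ?S] by simp
  qed
next
  assume nd: "[n = 0] (mod 20)" "[d = 6] (mod 20)"
  let ?S = "{0, 1, 3, 4, 10, 12, 14} :: int set"
  note p = congruence_parameters[OF nd _ _ _ assms(3), simplified]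
  have m: "(0 :: int) < 20" "20 dvd int n" and d0: "int d mod 20 = 6 mod 20"
    using p by simp_all
  have ne: "residue_nbhd 20 6 ?S a \<noteq> {}" if "a \<in> {0..<20}" for a
    using residues_20_6(2) that unfolding atLeastLessThan_upto list_all_iff by blast
  have C: "identifying_code (circulant_graph n [1, d]) (residue_code n 20 ?S)"
    by (rule residue_identifying[OF assms(1) m d0 ne])
      (use inj_on_distinct_map[OF residues_20_6(1)] in \<open>simp_all add: atLeastLessThan_upto\<close>)
  show "real (gamma_ID (circulant_graph n [1, d])) = 7 * real n / 20"
  proof (rule gamma_ID_circulant[OF _ _ C])
    show "2 \<le> d" "2 * d < n" using p by simp_all
    show "20 * card (residue_code n 20 ?S) = 7 * n"
      using card_residue_code[OF m, of ?S] by simp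
  qed
next
  assume nd: "[n = 0] (mod 20)" "[d = 5] (mod 20)"
  let ?S = "{0, 3, 6, 9, 13, 16} :: int set"
  note p = congruence_parameters[OF nd _ _ _ assms(3), simplified]
  have m: "(0 :: int) < 20" "20 dvd int n" and d0: "int d mod 20 = 5 mod 20"
    using p by simp_all
  have ne: "residue_nbhd 20 5 ?S a \<noteq> {}" if "a \<in> {0..<20}" for a
    using residues_20_5(2) that unfolding atLeastLessThan_upto list_all_iff by blast
  have "{0..<20} - ?S = set (filter (\<lambda>a. a \<notin> ?S) [0..19])"
    unfolding atLeastLessThan_upto by auto
  then have "inj_on (residue_nbhd 20 5 ?S) ({0..<20} - ?S)"
    using inj_on_distinct_map[OF residues_20_5(1)] by (simp only:)
  then have C: "locating_dominating_code (circulant_graph n [1, d]) (residue_code n 20 ?S)"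
    by (intro residue_locating[OF assms(1) m d0 ne]) simp_all
  show "real (gamma_LD (circulant_graph n [1, d])) = 3 * real n / 10"
  proof (rule gamma_LD_circulant[OF _ _ C])
    show "2 \<le> d" "2 * d < n" using p by simp_all
    show "10 * card (residue_code n 20 ?S) = 3 * n"
      using card_residue_code[OF m, of ?S] by simp
  qed
qed

end
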